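(* Let $\omega\in\mathbb{C}^3$ and let $\psi\in\Psi_\omega$ be an $\omega$-Markoff map. Then $\psi\in(\Psi_\omega)_Q$ if and only if the following two conditions are satisfied: (BQ1) for all $\xi\in\Upsilon^{(2)}$, $\psi(\xi)\notin[-2,2]$; (BQ2) for all $K>0$, the set $\Upsilon^{(2)}_\psi(K)$ is finite.
   Context: Curves and tree. $N$ is the real projective plane with three disjoint open disks removed, $\pi_1(N)=\langle\alpha_0,\beta_0,\gamma_0,\delta_0\mid\alpha_0\beta_0\gamma_0\delta_0\rangle$ (free of rank 3), where the generators are represented by one-sided simple closed curves pairwise intersecting once and $\alpha_0\beta_0,\beta_0\gamma_0,\alpha_0\gamma_0$ represent the three boundary components. $\mathcal{S}_1$ is the set of free homotopy classes of unoriented one-sided simple closed curves in $N$. $\Upsilon$ is the 4-valent tree dual to the curve complex of $N$. Its regions are $\Upsilon^{(3)}=\mathcal{S}_1$; its faces $\Upsilon^{(2)}$, edges $\Upsilon^{(1)}$, vertices $\Upsilon^{(0)}$ are respectively the unordered pairs, triples, quadruples of distinct elements of $\mathcal{S}_1$ with pairwise geometric intersection number 1. The face $(\alpha,\beta)$ is denoted $\xi_{\alpha,\beta}$. Each triple $(\alpha,\beta,\gamma)$ lies in exactly two quadruples $(\alpha,\beta,\gamma,\delta)$ and $(\alpha,\beta,\gamma,\delta')$, and is the edge joining these vertices. Regions are colored by $\{1,2,3,4\}$ by the unique coloring giving $\alpha_0,\beta_0,\gamma_0,\delta_0$ the colors $1,2,3,4$ and such that the four regions at each vertex have distinct colors;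 $\Upsilon^{(3)}_i$ is the set of regions of color $i$. Markoff maps. Let $\omega=(x,y,z)\in\mathbb{C}^3$, $M=\max\{|x|,|y|,|z|\}$, $\lambda_{12}=\lambda_{34}=x$, $\lambda_{23}=\lambda_{14}=y$, $\lambda_{13}=\lambda_{24}=z$, $\lambda_{ij}=\lambda_{ji}$. An $\omega$-Markoff map is a function $\psi:\Upsilon^{(3)}\cup\Upsilon^{(2)}\to\mathbb{C}$ such that: (i) at each vertex, with regions $\alpha_i\in\Upsilon^{(3)}_i$ and $a_i=\psi(\alpha_i)$, $\sum_i a_i^2+a_1a_2a_3a_4=x(a_1a_2+a_3a_4)+y(a_2a_3+a_1a_4)+z(a_1a_3+a_2a_4)+4-x^2-y^2-z^2-xyz$; (ii) for each edge $(\alpha_i,\alpha_j,\alpha_k)$ joining $(\alpha_i,\alpha_j,\alpha_k,\alpha_l)$ and $(\alpha_i,\alpha_j,\alpha_k,\alpha_l')$ (subscripts are colors), $\psi(\alpha_l)+\psi(\alpha_l')=\lambda_{il}\psi(\alpha_i)+\lambda_{jl}\psi(\alpha_j)+\lambda_{kl}\psi(\alpha_k)-\psi(\alpha_i)\psi(\alpha_j)\psi(\alpha_k)$; (iii) for each face $\xi=(\alpha_i,\alpha_j)$, $\psi(\alpha_i)\psi(\alpha_j)=\lambda_{ij}+\psi(\xi)$. $\Psi_\omega$ is the set of $\omega$-Markoff maps. For $\xi=(\alpha_i,\alpha_j)$ with values $a_i,a_j$ and any $k\ne i,j$ put $\sigma(\xi)=(a_i^2+a_j^2+\lambda_{ij}^2-a_ia_j\lambda_{ij}-4)(\lambda_{ik}^2+\lambda_{jk}^2+\psi(\xi)^2-\lambda_{ik}\lambda_{jk}\psi(\xi)-4)$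 (independent of $k$). For $K>0$, $\Upsilon^{(3)}_\psi(K)=\{\alpha\in\Upsilon^{(3)}:|\psi(\alpha)|<K\}$ and $\Upsilon^{(2)}_\psi(K)=\{\xi_{\alpha,\beta}\in\Upsilon^{(2)}: \alpha\text{ or }\beta\in\Upsilon^{(3)}_\psi(K),\ |\psi(\xi_{\alpha,\beta})|<K^2+M\}$. The Bowditch set $(\Psi_\omega)_Q$ is the set of $\psi\in\Psi_\omega$ such that $\psi(\xi)\notin[-2,2]$ for all $\xi\in\Upsilon^{(2)}$, $\sigma(\xi)\ne0$ for all $\xi\in\Upsilon^{(2)}$, and $\Upsilon^{(2)}_\psi(2+M)$ is finite. *)

theory Defs
  imports "HOL-Analysis.Analysis"
begin

section \<open>The three-holed projective plane\<close>

text \<open>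
  The line spanned by a unit vector \<open>v\<close> is represented by the orthogonal projection onto it,
  the matrix with entries \<open>v\<^sub>i v\<^sub>j\<close>. This embeds the projective plane in the space of
  3x3 matrices (\<open>v\<close> and \<open>-v\<close> have the same image, and nothing else is identified).
\<close>

definition line_of :: "real ^ 3 \<Rightarrow> real ^ 3 ^ 3" where
  "line_of v = (\<chi> i j. v $ i * v $ j)"

text \<open>
  The removed disks are the open caps \<open>v\<^sub>i\<^sup>2 > 3/4\<close> around the three coordinate axes. They have
  disjoint closures, because the squares of the coordinates add up to 1.
\<close>

definition N :: "(real ^ 3 ^ 3) set" where
  "N = line_of ` {v. norm v = 1 \<and> (\<forall>i. (v $ i)\<^sup>2 \<le> 3 / 4)}"

type_synonym curve = "real \<Rightarrow> real ^ 3 ^ 3"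

text \<open>A region is a free homotopy class of unoriented closed curves.\<close>

type_synonym region = "curve set"

definition simple_closed_curve :: "curve \<Rightarrow> bool" where
  "simple_closed_curve g \<longleftrightarrow>
     simple_path g \<and> pathfinish g = pathstart g \<and> path_image g \<subseteq> N"

text \<open>
  One-sided: \<open>g\<close> is the core of an embedded Moebius band, which is given by an injective
  map on the strip \<open>[0,1] \<times> [-1,1]\<close> with the sides \<open>s = 0\<close> and \<open>s = 1\<close> glued by \<open>t \<mapsto> -t\<close>.
\<close>

definition one_sided :: "curve \<Rightarrow> bool" where
  "one_sided g \<longleftrightarrow>
     (\<exists>h :: real \<times> real \<Rightarrow> real ^ 3 ^ 3.
        continuous_on ({0..1} \<times> {-1..1}) h \<and> h ` ({0..1} \<times> {-1..1}) \<subseteq> N \<and>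
        (\<forall>t\<in>{-1..1}. h (1, t) = h (0, - t)) \<and>
        inj_on h ({0..<1} \<times> {-1..1}) \<and>
        (\<forall>s\<in>{0..1}. h (s, 0) = g s))"

definition unoriented_class :: "curve \<Rightarrow> region" where
  "unoriented_class g = {q. homotopic_loops N g q \<or> homotopic_loops N (reversepath g) q}"

definition S1 :: "region set" where
  "S1 = {unoriented_class g |g. simple_closed_curve g \<and> one_sided g}"

text \<open>
  The geometric intersection number is minimised over simple representatives, so counting the
  points of intersection of the images counts each crossing once. Transversality need not be
  demanded: an isolated tangential contact can be perturbed away or into a single crossing.
\<close>

definition geom_intersection :: "region \<Rightarrow> region \<Rightarrow> nat" where
  "geom_intersection A B =
     (LEAST n. \<exists>p\<in>A. \<exists>q\<in>B. simple_closed_curve p \<and> simple_closed_curve q \<and>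
        finite (path_image p \<inter> path_image q) \<and> card (path_image p \<inter> path_image q) = n)"

text \<open>
  The projective line orthogonal to \<open>n\<close>, as a free homotopy class. All simple parametrisations
  of it define the same unoriented class.
\<close>

definition line_class :: "real ^ 3 \<Rightarrow> region" where
  "line_class n = {q. \<exists>g. simple_closed_curve g \<and>
     path_image g = line_of ` {v. norm v = 1 \<and> n \<bullet> v = 0} \<and> q \<in> unoriented_class g}"

text \<open>
  Four projective lines in general position cut the projective plane into four triangles and
  three quadrilaterals; here each quadrilateral contains one of the removed disks. Every
  permutation of the four lines is induced by a symmetry of \<open>N\<close>, so it does not matter
  which of them carries which name.
\<close>

definition alpha0 :: region where "alpha0 = line_class (vector [1, 1, 1])"
definition beta0 :: region where "beta0 = line_class (vector [1, 1, -1])"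
definition gamma0 :: region where "gamma0 = line_class (vector [1, -1, 1])"
definition delta0 :: region where "delta0 = line_class (vector [-1, 1, 1])"


section \<open>The tree \<open>\<Upsilon>\<close>\<close>

definition once_cliques :: "nat \<Rightarrow> region set set" where
  "once_cliques n =
     {s. s \<subseteq> S1 \<and> finite s \<and> card s = n \<and>
         (\<forall>A\<in>s. \<forall>B\<in>s. A \<noteq> B \<longrightarrow> geom_intersection A B = 1)}"

abbreviation regions :: "region set" where "regions \<equiv> S1"
abbreviation faces :: "region set set" where "faces \<equiv> once_cliques 2"
abbreviation edges :: "region set set" where "edges \<equiv> once_cliques 3"
abbreviation vertices :: "region set set" where "vertices \<equiv> once_cliques 4"

definition adjacent :: "region set \<Rightarrow> region set \<Rightarrow> bool" where
  "adjacent u v \<longleftrightarrow> u \<in> vertices \<and> v \<in> vertices \<and> u \<noteq> v \<and> u \<inter> v \<in> edges"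

definition connected_vertices :: "region set set \<Rightarrow> bool" where
  "connected_vertices U \<longleftrightarrow>
     (\<forall>u\<in>U. \<forall>v\<in>U. (u, v) \<in> {(a, b). a \<in> U \<and> b \<in> U \<and> adjacent a b}\<^sup>*)"

definition no_cycles :: bool where
  "no_cycles \<longleftrightarrow>
     \<not> (\<exists>us. 3 \<le> length us \<and> distinct us \<and>
          (\<forall>i<length us. adjacent (us ! i) (us ! ((i + 1) mod length us))))"

definition vertices_at :: "region set \<Rightarrow> region set set" where
  "vertices_at s = {v \<in> vertices. s \<subseteq> v}"

text \<open>
  The known structure of the curve complex of \<open>N\<close> (Scharlemann), which makes \<open>\<Upsilon>\<close> the 4-valent
  tree dual to it. It is stated as a proposition about the objects above and is not proved here.
  \<open>\<Upsilon>\<close> is a tree in which each triple is the edge joining exactly two quadruples (hence 4-valent,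
  a quadruple containing four triples). Duality means that the vertices around each region and
  around each face form a nonempty subtree.
\<close>

definition Upsilon_dual_tree :: bool where
  "Upsilon_dual_tree \<longleftrightarrow>
     vertices \<noteq> {} \<and> connected_vertices vertices \<and> no_cycles \<and>
     (\<forall>e\<in>edges. card (vertices_at e) = 2) \<and>
     (\<forall>s. s \<in> (\<lambda>A. {A}) ` regions \<union> faces \<longrightarrow>
        vertices_at s \<noteq> {} \<and> connected_vertices (vertices_at s))"

definition region_coloring :: "(region \<Rightarrow> nat) \<Rightarrow> bool" where
  "region_coloring col \<longleftrightarrow>
     (\<forall>A\<in>regions. col A \<in> {1..4}) \<and>
     col alpha0 = 1 \<and> col beta0 = 2 \<and> col gamma0 = 3 \<and> col delta0 = 4 \<and>
     (\<forall>v\<in>vertices. inj_on col v)"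


section \<open>Markoff maps\<close>

type_synonym parameter = "complex \<times> complex \<times> complex"

definition max_norm :: "parameter \<Rightarrow> real" where
  "max_norm w = (case w of (x, y, z) \<Rightarrow> Max {norm x, norm y, norm z})"

text \<open>Only used for distinct \<open>i, j\<close> in \<open>{1,2,3,4}\<close>; the value 0 elsewhere is a dummy.\<close>

definition lam :: "parameter \<Rightarrow> nat \<Rightarrow> nat \<Rightarrow> complex" where
  "lam w i j = (case w of (x, y, z) \<Rightarrow>
     if {i, j} = {1, 2} \<or> {i, j} = {3, 4} then x
     else if {i, j} = {2, 3} \<or> {i, j} = {1, 4} then y
     else if {i, j} = {1, 3} \<or> {i, j} = {2, 4} then z
     else 0)"

text \<open>
  A function on regions and faces: \<open>psi (Inl A)\<close> is the value at the region \<open>A\<close>,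
  \<open>psi (Inr {A, B})\<close> the value at the face \<open>(A, B)\<close>. Values outside \<open>regions\<close> and \<open>faces\<close>
  are irrelevant.
\<close>

type_synonym tree_map = "region + region set \<Rightarrow> complex"

definition vertex_relation :: "(region \<Rightarrow> nat) \<Rightarrow> parameter \<Rightarrow> tree_map \<Rightarrow> bool" where
  "vertex_relation col w psi \<longleftrightarrow> (case w of (x, y, z) \<Rightarrow>
     \<forall>A1 A2 A3 A4. {A1, A2, A3, A4} \<in> vertices \<and>
        col A1 = 1 \<and> col A2 = 2 \<and> col A3 = 3 \<and> col A4 = 4 \<longrightarrow>
        (let a1 = psi (Inl A1); a2 = psi (Inl A2); a3 = psi (Inl A3); a4 = psi (Inl A4)
         in a1\<^sup>2 + a2\<^sup>2 + a3\<^sup>2 + a4\<^sup>2 + a1 * a2 * a3 * a4 =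
            x * (a1 * a2 + a3 * a4) + y * (a2 * a3 + a1 * a4) + z * (a1 * a3 + a2 * a4)
            + 4 - x\<^sup>2 - y\<^sup>2 - z\<^sup>2 - x * y * z))"

definition edge_relation :: "(region \<Rightarrow> nat) \<Rightarrow> parameter \<Rightarrow> tree_map \<Rightarrow> bool" where
  "edge_relation col w psi \<longleftrightarrow>
     (\<forall>A B C D D'. {A, B, C} \<in> edges \<and> {A, B, C, D} \<in> vertices \<and> {A, B, C, D'} \<in> vertices \<and>
        D \<noteq> D' \<longrightarrow>
        psi (Inl D) + psi (Inl D') =
          lam w (col A) (col D) * psi (Inl A) + lam w (col B) (col D) * psi (Inl B)
          + lam w (col C) (col D) * psi (Inl C) - psi (Inl A) * psi (Inl B) * psi (Inl C))"

definition face_relation :: "(region \<Rightarrow> nat) \<Rightarrow> parameter \<Rightarrow> tree_map \<Rightarrow> bool" where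
  "face_relation col w psi \<longleftrightarrow>
     (\<forall>A B. {A, B} \<in> faces \<longrightarrow>
        psi (Inl A) * psi (Inl B) = lam w (col A) (col B) + psi (Inr {A, B}))"

definition Markoff_maps :: "(region \<Rightarrow> nat) \<Rightarrow> parameter \<Rightarrow> tree_map set" where
  "Markoff_maps col w =
     {psi. vertex_relation col w psi \<and> edge_relation col w psi \<and> face_relation col w psi}"

definition sigma_value ::
  "(region \<Rightarrow> nat) \<Rightarrow> parameter \<Rightarrow> tree_map \<Rightarrow> region \<Rightarrow> region \<Rightarrow> nat \<Rightarrow> complex" where
  "sigma_value col w psi A B k =
     (let i = col A; j = col B; a = psi (Inl A); b = psi (Inl B); f = psi (Inr {A, B})
      in (a\<^sup>2 + b\<^sup>2 + (lam w i j)\<^sup>2 - a * b * lam w i j - 4) *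
         ((lam w i k)\<^sup>2 + (lam w j k)\<^sup>2 + f\<^sup>2 - lam w i k * lam w j k * f - 4))"

definition sigma :: "(region \<Rightarrow> nat) \<Rightarrow> parameter \<Rightarrow> tree_map \<Rightarrow> region set \<Rightarrow> complex" where
  "sigma col w psi xi =
     (THE s. \<exists>A B k. xi = {A, B} \<and> A \<noteq> B \<and> k \<in> {1..4} - {col A, col B} \<and>
        s = sigma_value col w psi A B k)"

lemma lam_sym: "lam w i j = lam w j i"
  unfolding lam_def insert_commute[of i j] ..

lemma colors: "(i::nat) \<in> {1..4} \<longleftrightarrow> i = 1 \<or> i = 2 \<or> i = 3 \<or> i = 4"
  by auto

lemma sigma_value_indep:
  assumes "col A \<in> {1..4}" "col B \<in> {1..4}" "col A \<noteq> col B"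
    and "k \<in> {1..4} - {col A, col B}" "l \<in> {1..4} - {col A, col B}"
  shows "sigma_value col w psi A B k = sigma_value col w psi A B l"
proof -
  obtain x y z where w: "w = (x, y, z)" by (cases w)
  have "k = l \<or> lam w (col A) k = lam w (col B) l \<and> lam w (col B) k = lam w (col A) l"
    using assms unfolding Diff_iff colors w
    by (elim conjE disjE) (simp_all add: lam_def doubleton_eq_iff)
  then show ?thesis
    by (auto simp: sigma_value_def Let_def algebra_simps)
qed

lemma sigma_value_sym: "sigma_value col w psi A B k = sigma_value col w psi B A k"
  by (simp add: sigma_value_def Let_def lam_sym[of w "col A" "col B"] insert_commute algebra_simps)

lemma sigma_eq:
  assumes "col A \<in> {1..4}" "col B \<in> {1..4}" "col A \<noteq> col B"
    and k: "k \<in> {1..4} - {col A, col B}"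
  shows "sigma col w psi {A, B} = sigma_value col w psi A B k"
  unfolding sigma_def
proof (rule the_equality)
  show "\<exists>A' B' k'. {A, B} = {A', B'} \<and> A' \<noteq> B' \<and> k' \<in> {1..4} - {col A', col B'} \<and>
      sigma_value col w psi A B k = sigma_value col w psi A' B' k'"
    using assms by blast
next
  fix s
  assume "\<exists>A' B' k'. {A, B} = {A', B'} \<and> A' \<noteq> B' \<and> k' \<in> {1..4} - {col A', col B'} \<and>
      s = sigma_value col w psi A' B' k'"
  then obtain A' B' k' where *: "{A, B} = {A', B'}" "k' \<in> {1..4} - {col A', col B'}"
    "s = sigma_value col w psi A' B' k'" by blast
  then have "k' \<in> {1..4} - {col A, col B}" "s = sigma_value col w psi A B k'"
    by (auto simp: doubleton_eq_iff intro: sigma_value_sym)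
  then show "s = sigma_value col w psi A B k"
    using sigma_value_indep assms by metis
qed

definition small_regions :: "tree_map \<Rightarrow> real \<Rightarrow> region set" where
  "small_regions psi K = {A \<in> regions. norm (psi (Inl A)) < K}"

definition small_faces :: "parameter \<Rightarrow> tree_map \<Rightarrow> real \<Rightarrow> region set set" where
  "small_faces w psi K =
     {xi \<in> faces. (\<exists>A\<in>xi. A \<in> small_regions psi K) \<and> norm (psi (Inr xi)) < K\<^sup>2 + max_norm w}"

definition Bowditch_set :: "(region \<Rightarrow> nat) \<Rightarrow> parameter \<Rightarrow> tree_map set" where
  "Bowditch_set col w =
     {psi \<in> Markoff_maps col w.
        (\<forall>xi\<in>faces. psi (Inr xi) \<notin> complex_of_real ` {-2..2}) \<and>
        (\<forall>xi\<in>faces. sigma col w psi xi \<noteq> 0) \<and>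
        finite (small_faces w psi (2 + max_norm w))}"

end

theory Submission
  imports Defs
begin

text \<open>
  Call a vertex thin (for \<open>K\<close>) if one of its six faces lies in \<open>\<Upsilon>\<^sup>(\<^sup>2\<^sup>)\<^sub>\<psi>(K)\<close>, and orient every edge of the tree
  towards the end with the smaller value. For \<open>K \<ge> 2 + M\<close> any two regions at a vertex that is not
  thin have values whose product is at least \<open>K\<^sup>2\<close> in modulus, and the edge relation then shows
  that at most one edge points away from such a vertex. The estimates have some slack: an edge
  from a vertex with a small face for \<open>K + 1/4\<close> to a vertex that is not thin for \<open>K\<close> and misses
  that face points backwards. Hence a path between two small faces for \<open>K + 1/4\<close> cannot have all
  its vertices not thin, and every such face comes within distance one of a thin vertex (or, if
  no vertex is thin, any two such faces share a vertex).

  Around a face \<open>\<xi>\<close> the values satisfy a linear recurrence of order two with an invariant that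
  vanishes exactly when \<open>\<sigma>(\<xi>) = 0\<close>. If \<open>\<psi>(\<xi>) \<notin> [-2,2]\<close> and \<open>\<sigma>(\<xi>) \<noteq> 0\<close>, they grow
  exponentially in both directions, so only finitely many small faces come near the line of \<open>\<xi>\<close>;
  thus finiteness passes from \<open>K\<close> to \<open>K + 1/4\<close>, hence from \<open>2 + M\<close> to every \<open>K\<close>. If \<open>\<sigma>(\<xi>) = 0\<close>,
  they stay bounded in one direction, which gives infinitely many small faces for large \<open>K\<close>.
\<close>

section \<open>Elementary inequalities\<close>

text \<open>Adding the last two hypotheses gives
  \<open>(a * b - (2 + M)) * (c + d) \<le> 2 * M * (a + b)\<close>. With \<open>a \<le> b\<close>
  the right side is at most \<open>4 * M * b\<close>, while \<open>a * c\<close> and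
  \<open>a * d\<close> are at least \<open>K^2\<close>; cancelling \<open>b\<close> leaves
  \<open>K * (K - 1) \<le> 2 * M \<le> 2 * (K - 2)\<close>, which is impossible.\<close>

lemma fork_arith:
  fixes a b c d K M :: real
  assumes M: "0 \<le> M" "2 + M \<le> K"
    and nn: "0 \<le> a" "0 \<le> b" "0 \<le> c" "0 \<le> d"
    and ge: "K\<^sup>2 \<le> a * b" "K\<^sup>2 \<le> a * c" "K\<^sup>2 \<le> a * d" "K\<^sup>2 \<le> b * c" "K\<^sup>2 \<le> b * d"
    and d: "a * b * c - M * (a + b + c) \<le> 2 * d"
    and c: "a * b * d - M * (a + b + d) \<le> 2 * c"
  shows False
  using nn(1,2) ge d c
proof (induction a b rule: linorder_wlog)
  case (le a b)
  have K: "2 \<le> K" using M by simp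
  have b: "0 < b"
  proof (rule ccontr)
    assume "\<not> 0 < b" then have "b = 0" using le by simp
    then show False using le.prems(3) K by simp
  qed
  have s: "(a * b - K) * (c + d) \<le> 2 * M * (a + b)"
  proof -
    have "(a * b - (2 + M)) * (c + d) \<le> 2 * M * (a + b)"
      using le.prems(8,9) by (simp add: algebra_simps)
    moreover have "(a * b - K) * (c + d) \<le> (a * b - (2 + M)) * (c + d)"
      using M nn by (intro mult_right_mono) auto
    ultimately show ?thesis by linarith
  qed
  \<comment> \<open>A rearrangement of \<open>K^2 \<le> a * b\<close>, chosen so that a multiple of
    \<open>a * b\<close> replaces the difference \<open>a * b - K\<close>.\<close>
  have "a * b * (K - 1) \<le> K * (a * b - K)"
    using le.prems(3) by (simp add: algebra_simps power2_eq_square)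
  then have "a * b * (K - 1) * (c + d) \<le> K * (a * b - K) * (c + d)"
    using nn by (intro mult_right_mono) auto
  also have "\<dots> \<le> K * (2 * M * (a + b))"
    using mult_left_mono[OF s, of K] K by (simp add: mult.assoc)
  also have "\<dots> \<le> K * (2 * M * (b + b))"
    using le M K by (intro mult_left_mono) auto
  finally have 1: "a * b * (K - 1) * (c + d) \<le> 4 * K * M * b" by simp
  have "(K - 1) * b * (2 * K\<^sup>2) \<le> (K - 1) * b * (a * c + a * d)"
    using le.prems K b by (intro mult_left_mono) auto
  also have "\<dots> = a * b * (K - 1) * (c + d)" by (simp add: algebra_simps)
  finally have "(2 * (K - 1) * K) * (K * b) \<le> 4 * M * (K * b)"
    using 1 by (simp add: algebra_simps power2_eq_square)
  then have "2 * (K - 1) * K \<le> 4 * M"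
    using K b by (simp add: mult_le_cancel_right)
  then have "K * K - K \<le> 2 * (K - 2)" using M by (simp add: algebra_simps)
  moreover have "0 < (K - 3 / 2)\<^sup>2 + 7/4" by (simp add: add_nonneg_pos)
  ultimately show False by (simp add: power2_eq_square algebra_simps)
next
  case (sym a b)
  show ?case by (rule sym.IH) (use sym.prems in \<open>simp_all add: algebra_simps\<close>)
qed

text \<open>If \<open>a < K + 1/4\<close>, multiply the last hypothesis by \<open>a\<close>: the
  left side contains \<open>(a * b - M) * (a * c - M)\<close> and is of order \<open>K^4\<close>,
  the right side only of order \<open>K^2\<close>. Otherwise \<open>d < K + 1/4 \<le> a\<close>,
  whereas the largest of \<open>a\<close>, \<open>b\<close>, \<open>c\<close> turns out to be at
  most \<open>d\<close>.\<close>

lemma rise_arith: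
  fixes a b c d K M :: real
  assumes M: "0 \<le> M" "2 + M \<le> K"
    and nn: "0 \<le> a" "0 \<le> b" "0 \<le> c" "0 \<le> d"
    and ge: "K\<^sup>2 \<le> a * b" "K\<^sup>2 \<le> a * c" "K\<^sup>2 \<le> b * c"
    and small: "a < K + 1/4 \<or> d < K + 1/4" "a * d < (K + 1/4)\<^sup>2 + 2 * M"
    and d: "a * b * c - M * (a + b + c) \<le> 2 * d"
  shows False
proof (cases "a < K + 1/4")
  case True
  have K: "2 \<le> K" using M by simp
  have "K * 2 \<le> K * K" using K by (intro mult_left_mono) auto
  then have KM: "0 \<le> K\<^sup>2 - M" using M K unfolding power2_eq_square by linarith
  have "a * (a * b * c - M * (a + b + c)) \<le> a * (2 * d)"
    using d nn by (intro mult_left_mono) auto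
  then have 1: "(a * b - M) * (a * c - M) - M\<^sup>2 - M * a\<^sup>2 \<le> 2 * (a * d)"
    by (simp add: algebra_simps power2_eq_square)
  have 2: "(K\<^sup>2 - M) * (K\<^sup>2 - M) \<le> (a * b - M) * (a * c - M)"
    using ge KM by (intro mult_mono) auto
  have 3: "M * a\<^sup>2 \<le> M * (K + 1/4)\<^sup>2"
    using True nn M by (intro mult_left_mono power_mono) auto
  have "K^4 - 2 * M * K\<^sup>2 < (M + 2) * (K + 1/4)\<^sup>2 + 4 * M"
  proof -
    have "(K\<^sup>2 - M) * (K\<^sup>2 - M) - M\<^sup>2 = K^4 - 2 * M * K\<^sup>2"
      "(M + 2) * (K + 1/4)\<^sup>2 = M * (K + 1/4)\<^sup>2 + 2 * (K + 1/4)\<^sup>2" by algebra+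
    then show ?thesis using 1 2 3 small(2) by linarith
  qed
  moreover have "M * K\<^sup>2 \<le> (K - 2) * K\<^sup>2"
    using M by (intro mult_right_mono) auto
  moreover have "(M + 2) * (K + 1/4)\<^sup>2 \<le> K * (K + 1/4)\<^sup>2"
    using M by (intro mult_right_mono) auto
  ultimately have k: "K^4 - 2 * ((K - 2) * K\<^sup>2) - K * (K + 1/4)\<^sup>2 - 4 * (K - 2) < 0"
    using M by (simp add: algebra_simps)
  \<comment> \<open>In terms of \<open>t = K - 2\<close> the polynomial has only positive
    coefficients; its constant term \<open>47/8\<close> is the room that the increment
    \<open>1/4\<close> leaves at \<open>K = 2\<close>.\<close>
  obtain t where t: "K = t + 2" "0 \<le> t" using K by (metis add.commute le_add_diff_inverse diff_ge_0_iff_ge)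
  have "(t + 2)^4 - 2 * t * (t+2)\<^sup>2 - (t+2) * (t + 9/4)\<^sup>2 - 4 * t < 0"
    using k unfolding t(1) by (simp add: algebra_simps)
  moreover have "(t + 2)^4 - 2 * t * (t+2)\<^sup>2 - (t+2) * (t + 9/4)\<^sup>2 - 4 * t =
      t^4 + 5 * t^3 + 19/2 * t\<^sup>2 + 95/16 * t + 47/8"
    by (simp add: field_simps power2_eq_square power3_eq_cube power4_eq_xxxx)
  moreover have "0 \<le> t^2" "0 \<le> t^3" "0 \<le> t^4" using t(2) by auto
  ultimately show False using t(2) by linarith
next
  case False
  have K: "2 \<le> K" using M by simp
  have q: "2 \<le> K\<^sup>2 - 3 * M"
  proof -
    have "0 \<le> (K - 3 / 2)\<^sup>2" by simp
    then show ?thesis using M by (simp add: power2_eq_square algebra_simps)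
  qed
  \<comment> \<open>The largest of the three values is multiplied in \<open>a * b * c\<close> by a
    product of two others, which is at least \<open>K^2\<close>.\<close>
  define m where "m = max a (max b c)"
  have m: "K + 1/4 \<le> m" "0 \<le> m" "a \<le> m" "b \<le> m" "c \<le> m" using False K by (auto simp: m_def)
  have "m = a \<or> m = b \<or> m = c" by (auto simp: m_def max_def)
  then have "m * K\<^sup>2 \<le> a * b * c"
  proof (elim disjE)
    assume "m = a"
    then show ?thesis using mult_left_mono[OF ge(3), of a] nn by (simp add: mult.assoc)
  next
    assume "m = b"
    then show ?thesis using mult_left_mono[OF ge(2), of b] nn by (simp add: algebra_simps)
  next
    assume "m = c"
    then show ?thesis using mult_left_mono[OF ge(1), of c] nn by (simp add: algebra_simps)
  qed
  moreover have "M * (a + b + c) \<le> M * (m + m + m)"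
    using m M by (intro mult_left_mono) auto
  ultimately have "m * (K\<^sup>2 - 3 * M) \<le> 2 * d" using d by (simp add: algebra_simps)
  moreover have "m * 2 \<le> m * (K\<^sup>2 - 3 * M)" using q m by (intro mult_left_mono) auto
  ultimately show False using small False m by linarith
qed

section \<open>Linear recurrences of order two\<close>

text \<open>The roots of \<open>t^2 + f * t + 1\<close> are inverse to each other. If they lay on
  the unit circle they would be conjugate, and \<open>- f\<close> would be twice a real part, so
  \<open>f\<close> would lie in \<open>[-2,2]\<close>. Hence one of them lies outside the
  circle.\<close>

lemma exists_multiplier:
  fixes f :: complex
  assumes "f \<notin> complex_of_real ` {-2..2}"
  obtains t where "1 < norm t" "t + inverse t = - f"
proof -
  define r where "r = csqrt (f\<^sup>2 - 4)"
  define s where "s = (r - f) / 2"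
  have "r\<^sup>2 = f\<^sup>2 - 4" unfolding r_def by (rule power2_csqrt)
  moreover have "s\<^sup>2 + f * s + 1 = (r\<^sup>2 - f\<^sup>2 + 4) / 4"
    unfolding s_def by (simp add: power2_eq_square field_simps)
  ultimately have s: "s\<^sup>2 + f * s + 1 = 0" by simp
  then have "s \<noteq> 0" by auto
  have "s * s + 1 = - f * s" using s by (simp add: power2_eq_square eq_neg_iff_add_eq_0 ac_simps)
  then have e: "s + inverse s = - f"
    using \<open>s \<noteq> 0\<close> by (simp add: field_simps)
  have "norm s \<noteq> 1"
  proof
    assume n: "norm s = 1"
    then have "s * cnj s = 1" using complex_norm_square[of s] by simp
    then have "inverse s = cnj s" by (rule inverse_unique)
    then have "f = complex_of_real (- 2 * Re s)"
      using e by (simp add: complex_eq_iff)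
    moreover have "- 2 * Re s \<in> {-2..2}" using abs_Re_le_cmod[of s] n by auto
    ultimately show False using assms by blast
  qed
  show ?thesis
  proof (cases "1 < norm s")
    case True then show ?thesis using e that by blast
  next
    case False
    then have "1 < norm (inverse s)" using \<open>norm s \<noteq> 1\<close> \<open>s \<noteq> 0\<close>
      by (simp add: norm_inverse one_less_inverse_iff)
    then show ?thesis using e that[of "inverse s"] by (simp add: add.commute)
  qed
qed

text \<open>The recurrence operator factors into two first-order operators with multipliers
  \<open>L\<close> and \<open>inverse L\<close>; what either factor leaves is a geometric
  progression of the other ratio.\<close>

lemma recurrence_factors:
  fixes h :: "nat \<Rightarrow> complex"
  assumes L: "L + inverse L = - f" "L \<noteq> 0"
    and rec: "\<And>n. h (Suc (Suc n)) + f * h (Suc n) + h n = 0"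
  shows "h (Suc n) - L * h n = inverse L ^ n * (h 1 - L * h 0)"
    and "h (Suc n) - inverse L * h n = L ^ n * (h 1 - inverse L * h 0)"
proof -
  have r: "h (Suc (Suc n)) = (L + inverse L) * h (Suc n) - h n" for n
    using rec[of n] unfolding L(1) by (simp add: algebra_simps eq_neg_iff_add_eq_0)
  have "h (Suc (Suc n)) - L * h (Suc n) = inverse L * (h (Suc n) - L * h n)" for n
    unfolding r using L(2) by (simp add: field_simps)
  then show "h (Suc n) - L * h n = inverse L ^ n * (h 1 - L * h 0)"
    by (induction n) simp_all
  have "h (Suc (Suc n)) - inverse L * h (Suc n) = L * (h (Suc n) - inverse L * h n)" for n
    unfolding r using L(2) by (simp add: field_simps)
  then show "h (Suc n) - inverse L * h n = L ^ n * (h 1 - inverse L * h 0)"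
    by (induction n) simp_all
qed

lemma recurrence_solution:
  fixes h :: "nat \<Rightarrow> complex"
  assumes L: "L + inverse L = - f" "L \<noteq> 0"
    and rec: "\<And>n. h (Suc (Suc n)) + f * h (Suc n) + h n = 0"
  shows "(L - inverse L) * h n =
    L ^ n * (h 1 - inverse L * h 0) - inverse L ^ n * (h 1 - L * h 0)"
proof -
  have "(L - inverse L) * h n = (h (Suc n) - inverse L * h n) - (h (Suc n) - L * h n)"
    by (simp add: algebra_simps)
  then show ?thesis unfolding recurrence_factors[where h = h, OF assms] .
qed

text \<open>The coefficients of the growing and of the decaying mode multiply to the quadratic form
  that the recurrence preserves, so the form vanishes exactly when one of the two modes is
  missing.\<close>

lemma recurrence_invariant:
  fixes a b :: complex
  assumes L: "L + inverse L = - f" "L \<noteq> 0"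
  shows "(b - L * a) * (b - inverse L * a) = a\<^sup>2 + b\<^sup>2 + f * a * b"
proof -
  have "(b - L * a) * (b - inverse L * a) = b\<^sup>2 - (L + inverse L) * a * b + a\<^sup>2 * (L * inverse L)"
    by (simp add: algebra_simps power2_eq_square)
  then show ?thesis using L by simp
qed

text \<open>The nonzero form forces a nonzero coefficient \<open>q\<close> of \<open>L ^ n\<close>,
  and the contribution of the other mode stays bounded.\<close>

lemma recurrence_at_top:
  fixes h :: "nat \<Rightarrow> complex"
  assumes L: "L + inverse L = - f" "1 < norm L"
    and rec: "\<And>n. h (Suc (Suc n)) + f * h (Suc n) + h n = 0"
    and nz: "(h 0)\<^sup>2 + (h 1)\<^sup>2 + f * h 0 * h 1 \<noteq> 0"
  shows "filterlim (\<lambda>n. norm (h n)) at_top sequentially"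
proof -
  have L0: "L \<noteq> 0" using L(2) by auto
  define p q where "p = h 1 - L * h 0" and "q = h 1 - inverse L * h 0"
  have "q \<noteq> 0" using nz recurrence_invariant[OF L(1) L0, of "h 1" "h 0"] by (auto simp: q_def)
  define l where "l = norm (L - inverse L)"
  have "norm (inverse L) < 1" using L(2) L0 by (simp add: norm_inverse inverse_less_1_iff)
  then have "0 < l" using L(2) norm_triangle_ineq2[of L "inverse L"] unfolding l_def by linarith
  have "(norm q * norm L ^ n - norm p) / l \<le> norm (h n)" for n
  proof -
    have "norm (L ^ n * q) - norm (inverse L ^ n * p) \<le> norm ((L - inverse L) * h n)"
      unfolding recurrence_solution[where h = h, OF L(1) L0 rec] p_def q_def by (rule norm_triangle_ineq2)
    moreover have "norm (inverse L ^ n * p) \<le> norm p"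
      using \<open>norm (inverse L) < 1\<close> unfolding norm_mult norm_power
      by (intro mult_left_le_one_le power_le_one) auto
    ultimately have "norm q * norm L ^ n - norm p \<le> norm (h n) * l"
      unfolding norm_mult[of "L - _"] norm_mult[of _ q] norm_power l_def[symmetric]
      by (simp add: mult.commute)
    then show ?thesis using \<open>0 < l\<close> by (simp add: pos_divide_le_eq)
  qed
  moreover have "filterlim (\<lambda>n. (norm q * norm L ^ n - norm p) / l) at_top sequentially"
  proof -
    have "filterlim (\<lambda>n. norm q * norm L ^ n) at_top sequentially"
      using \<open>q \<noteq> 0\<close> filterlim_at_infinity_imp_norm_at_top[OF filterlim_realpow_sequentially_gt1[OF L(2)]]
      by (intro filterlim_tendsto_pos_mult_at_top[OF tendsto_const]) (auto simp: norm_power)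
    then have "filterlim (\<lambda>n. - norm p + norm q * norm L ^ n) at_top sequentially"
      by (rule filterlim_tendsto_add_at_top[OF tendsto_const])
    then have "filterlim (\<lambda>n. inverse l * (- norm p + norm q * norm L ^ n)) at_top sequentially"
      using \<open>0 < l\<close> by (intro filterlim_tendsto_pos_mult_at_top[OF tendsto_const]) auto
    then show ?thesis by (simp add: field_simps)
  qed
  ultimately show ?thesis
    by (intro filterlim_at_top_mono[where g = "\<lambda>n. norm (h n)"]) auto
qed

text \<open>The hypothesis on \<open>h 1\<close> says that the growing mode is missing, so
  \<open>h\<close> is geometric with ratio \<open>inverse L\<close>.\<close>

lemma recurrence_bounded:
  fixes h :: "nat \<Rightarrow> complex"
  assumes L: "L + inverse L = - f" "1 < norm L"
    and rec: "\<And>n. h (Suc (Suc n)) + f * h (Suc n) + h n = 0"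
    and z: "h 1 = inverse L * h 0"
  shows "norm (h n) \<le> norm (h 0)"
proof -
  have L0: "L \<noteq> 0" using L(2) by auto
  have s: "h (Suc n) = inverse L * h n" for n
    using recurrence_factors(2)[where h = h, OF L(1) L0 rec, of n] z by simp
  have "norm (inverse L) \<le> 1" using L(2) L0 by (simp add: norm_inverse inverse_le_1_iff)
  then have "norm (h (Suc n)) \<le> norm (h n)" for n
    unfolding s norm_mult by (intro mult_left_le_one_le) auto
  then show ?thesis by (induction n) (auto intro: order_trans)
qed

text \<open>The values met along a face satisfy a linear recurrence whose inhomogeneous term alternates;
  subtracting its alternating solution makes the recurrence homogeneous.\<close>

definition shift_even :: "complex \<Rightarrow> complex \<Rightarrow> complex \<Rightarrow> complex" where
  "shift_even f s t = (2 * s - f * t) / (4 - f\<^sup>2)"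

text \<open>The alternating solution takes the values \<open>u\<close>, \<open>v\<close> with
  \<open>2 * u + f * v = s\<close> and \<open>2 * v + f * u = t\<close>, a linear system of
  determinant \<open>4 - f^2\<close>. Multiplying the form of \<open>h\<close> by this determinant
  makes it a polynomial in the original data, to be compared with \<open>sigma\<close>
  later.\<close>

lemma alternating_recurrence_shift:
  fixes c :: "nat \<Rightarrow> complex"
  assumes f: "f\<^sup>2 \<noteq> 4"
    and rec: "\<And>n. c (Suc (Suc n)) + f * c (Suc n) + c n = (if even n then s else t)"
  defines "h \<equiv> \<lambda>n. c n - (if even n then shift_even f s t else shift_even f t s)"
  shows "h (Suc (Suc n)) + f * h (Suc n) + h n = 0"
    and "(4 - f\<^sup>2) * ((h 0)\<^sup>2 + (h 1)\<^sup>2 + f * h 0 * h 1) =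
      (4 - f\<^sup>2) * ((c 0)\<^sup>2 + (c 1)\<^sup>2 + f * c 0 * c 1 - s * c 0 - t * c 1) + s\<^sup>2 + t\<^sup>2 - f * s * t"
proof -
  define u v where "u = shift_even f s t" and "v = shift_even f t s"
  have d: "4 - f\<^sup>2 \<noteq> 0" using f by auto
  have du: "(4 - f\<^sup>2) * u = 2 * s - f * t" and dv: "(4 - f\<^sup>2) * v = 2 * t - f * s"
    unfolding u_def v_def shift_even_def using d by simp_all
  have "(4 - f\<^sup>2) * (2 * u + f * v - s) = 2 * ((4 - f\<^sup>2) * u) + f * ((4 - f\<^sup>2) * v) - (4 - f\<^sup>2) * s"
    by algebra
  also have "\<dots> = 0" unfolding du dv by algebra
  finally have su: "2 * u + f * v = s" using d by simp
  have "(4 - f\<^sup>2) * (2 * v + f * u - t) = 2 * ((4 - f\<^sup>2) * v) + f * ((4 - f\<^sup>2) * u) - (4 - f\<^sup>2) * t"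
    by algebra
  also have "\<dots> = 0" unfolding du dv by algebra
  finally have tv: "2 * v + f * u = t" using d by simp
  have h: "h n = c n - (if even n then u else v)" for n by (simp add: h_def u_def v_def)
  show "h (Suc (Suc n)) + f * h (Suc n) + h n = 0"
    using rec[of n] su tv unfolding h by (cases "even n") (simp_all add: algebra_simps)
  have c0: "c 0 = h 0 + u" and c1: "c 1 = h 1 + v" by (simp_all add: h)
  show "(4 - f\<^sup>2) * ((h 0)\<^sup>2 + (h 1)\<^sup>2 + f * h 0 * h 1) =
      (4 - f\<^sup>2) * ((c 0)\<^sup>2 + (c 1)\<^sup>2 + f * c 0 * c 1 - s * c 0 - t * c 1) + s\<^sup>2 + t\<^sup>2 - f * s * t"
    unfolding c0 c1 unfolding su[symmetric] tv[symmetric] by algebra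
qed

lemma square_eq_4: "f \<notin> complex_of_real ` {-2..2} \<Longrightarrow> f\<^sup>2 \<noteq> 4"
proof
  assume f: "f \<notin> complex_of_real ` {-2..2}" "f\<^sup>2 = 4"
  then have "(f - 2) * (f + 2) = 0" by (simp add: algebra_simps power2_eq_square)
  then have "f = complex_of_real 2 \<or> f = complex_of_real (-2)"
    by (auto simp: eq_neg_iff_add_eq_0)
  moreover have "complex_of_real 2 \<in> complex_of_real ` {-2..2}"
    "complex_of_real (-2) \<in> complex_of_real ` {-2..2}" by (intro imageI; simp)+
  ultimately show False using f(1) by metis
qed

lemma alternating_recurrence_at_top:
  fixes c :: "nat \<Rightarrow> complex"
  assumes f: "f \<notin> complex_of_real ` {-2..2}"
    and rec: "\<And>n. c (Suc (Suc n)) + f * c (Suc n) + c n = (if even n then s else t)"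
    and nz: "(4 - f\<^sup>2) * ((c 0)\<^sup>2 + (c 1)\<^sup>2 + f * c 0 * c 1 - s * c 0 - t * c 1)
      + s\<^sup>2 + t\<^sup>2 - f * s * t \<noteq> 0"
  shows "filterlim (\<lambda>n. norm (c n)) at_top sequentially"
proof -
  obtain L where L: "1 < norm L" "L + inverse L = - f" using exists_multiplier[OF f] by blast
  define u v where "u = shift_even f s t" and "v = shift_even f t s"
  define h where "h = (\<lambda>n. c n - (if even n then u else v))"
  have S: "h (Suc (Suc n)) + f * h (Suc n) + h n = 0" for n
    unfolding h_def u_def v_def by (rule alternating_recurrence_shift(1)[OF square_eq_4[OF f] rec])
  have J: "(4 - f\<^sup>2) * ((h 0)\<^sup>2 + (h 1)\<^sup>2 + f * h 0 * h 1) =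
      (4 - f\<^sup>2) * ((c 0)\<^sup>2 + (c 1)\<^sup>2 + f * c 0 * c 1 - s * c 0 - t * c 1) + s\<^sup>2 + t\<^sup>2 - f * s * t"
    unfolding h_def u_def v_def by (rule alternating_recurrence_shift(2)[OF square_eq_4[OF f] rec])
  have "filterlim (\<lambda>n. norm (h n)) at_top sequentially"
    using nz J by (intro recurrence_at_top[where h = h, OF L(2,1) S]) force
  then have "filterlim (\<lambda>n. - (norm u + norm v) + norm (h n)) at_top sequentially"
    by (rule filterlim_tendsto_add_at_top[OF tendsto_const])
  moreover have "- (norm u + norm v) + norm (h n) \<le> norm (c n)" for n
    using norm_triangle_ineq4[of "c n" u] norm_triangle_ineq4[of "c n" v]
      norm_ge_zero[of u] norm_ge_zero[of v] by (auto simp: h_def simp del: norm_ge_zero)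
  ultimately show ?thesis by (intro filterlim_at_top_mono[where g = "\<lambda>n. norm (c n)"]) auto
qed

text \<open>The sequences \<open>c\<close> and \<open>d\<close> are the two halves of one two-sided
  sequence, which is why they start with the same two values in opposite order. One of the two modes
  is missing; the mode growing in one direction decays in the other, so one half is bounded.\<close>

lemma alternating_recurrence_bounded:
  fixes c d :: "nat \<Rightarrow> complex"
  assumes f: "f \<notin> complex_of_real ` {-2..2}"
    and c: "\<And>n. c (Suc (Suc n)) + f * c (Suc n) + c n = (if even n then s else t)"
    and d: "\<And>n. d (Suc (Suc n)) + f * d (Suc n) + d n = (if even n then t else s)"
    and cd: "d 0 = c 1" "d 1 = c 0"
    and z: "(4 - f\<^sup>2) * ((c 0)\<^sup>2 + (c 1)\<^sup>2 + f * c 0 * c 1 - s * c 0 - t * c 1)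
      + s\<^sup>2 + t\<^sup>2 - f * s * t = 0"
  shows "(\<exists>T. \<forall>n. norm (c n) \<le> T) \<or> (\<exists>T. \<forall>n. norm (d n) \<le> T)"
proof -
  obtain L where L: "1 < norm L" "L + inverse L = - f" using exists_multiplier[OF f] by blast
  then have L0: "L \<noteq> 0" by auto
  define u v where "u = shift_even f s t" and "v = shift_even f t s"
  define h where "h = (\<lambda>n. c n - (if even n then u else v))"
  define g where "g = (\<lambda>n. d n - (if even n then v else u))"
  have H: "h (Suc (Suc n)) + f * h (Suc n) + h n = 0" for n
    unfolding h_def u_def v_def by (rule alternating_recurrence_shift(1)[OF square_eq_4[OF f] c])
  have J: "(4 - f\<^sup>2) * ((h 0)\<^sup>2 + (h 1)\<^sup>2 + f * h 0 * h 1) =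
      (4 - f\<^sup>2) * ((c 0)\<^sup>2 + (c 1)\<^sup>2 + f * c 0 * c 1 - s * c 0 - t * c 1) + s\<^sup>2 + t\<^sup>2 - f * s * t"
    unfolding h_def u_def v_def by (rule alternating_recurrence_shift(2)[OF square_eq_4[OF f] c])
  have G: "g (Suc (Suc n)) + f * g (Suc n) + g n = 0" for n
    unfolding g_def u_def v_def by (rule alternating_recurrence_shift(1)[OF square_eq_4[OF f] d])
  have gh: "g 0 = h 1" "g 1 = h 0" using cd by (simp_all add: g_def h_def)
  have "(h 0)\<^sup>2 + (h 1)\<^sup>2 + f * h 0 * h 1 = 0"
    using J z square_eq_4[OF f] by (metis eq_iff_diff_eq_0 mult_eq_0_iff)
  then have "h 1 = L * h 0 \<or> h 1 = inverse L * h 0"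
    using recurrence_invariant[OF L(2) L0, of "h 1" "h 0"] by auto
  then show ?thesis
  proof
    assume "h 1 = L * h 0"
    then have "g 1 = inverse L * g 0" using L0 unfolding gh by (simp add: field_simps)
    then have 1: "norm (g n) \<le> norm (g 0)" for n by (rule recurrence_bounded[where h = g, OF L(2,1) G])
    have "norm (d n) \<le> norm (g 0) + (norm u + norm v)" for n
    proof -
      have "norm (d n) \<le> norm (g n) + norm (if even n then v else u)"
        using norm_triangle_ineq[of "g n" "if even n then v else u"] by (simp add: g_def)
      moreover have "norm (if even n then v else u) \<le> norm u + norm v" by simp
      ultimately show ?thesis using 1[of n] by linarith
    qed
    then show ?thesis by blast
  next
    assume "h 1 = inverse L * h 0"
    then have 1: "norm (h n) \<le> norm (h 0)" for n by (rule recurrence_bounded[where h = h, OF L(2,1) H])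
    have "norm (c n) \<le> norm (h 0) + (norm u + norm v)" for n
    proof -
      have "norm (c n) \<le> norm (h n) + norm (if even n then u else v)"
        using norm_triangle_ineq[of "h n" "if even n then u else v"] by (simp add: h_def)
      moreover have "norm (if even n then u else v) \<le> norm u + norm v" by simp
      ultimately show ?thesis using 1[of n] by linarith
    qed
    then show ?thesis by blast
  qed
qed

section \<open>Markoff maps on a tree\<close>

lemma max_norm_nonneg: "0 \<le> max_norm w"
  by (cases w) (auto simp: max_norm_def max_def)

lemma norm_lam_le: "norm (lam w i j) \<le> max_norm w"
  by (cases w) (auto simp: max_norm_def lam_def max_def)

text \<open>Cardinality replaces membership of the intersection in the set of edges, so that no
  separate set of edges has to be carried along; \<open>adjacent_iff\<close> justifies this for
  curves.\<close>

definition adj_in :: "'a set set \<Rightarrow> 'a set \<Rightarrow> 'a set \<Rightarrow> bool" where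
  "adj_in V u v \<longleftrightarrow> u \<in> V \<and> v \<in> V \<and> u \<noteq> v \<and> card (u \<inter> v) = 3"

definition connected_in :: "'a set set \<Rightarrow> 'a set set \<Rightarrow> bool" where
  "connected_in V U \<longleftrightarrow> (\<forall>u\<in>U. \<forall>v\<in>U. (u, v) \<in> {(a, b). a \<in> U \<and> b \<in> U \<and> adj_in V a b}\<^sup>*)"

text \<open>The parameters \<open>x\<close>, \<open>y\<close>, \<open>z\<close> belong to the three
  splittings of the four colors into two pairs. Every permutation of the colors permutes these
  splittings, and the relation is symmetric under this joint action; the 24 cases are checked one by
  one.\<close>

lemma vertex_relation_permute:
  fixes h :: "nat \<Rightarrow> complex"
  assumes col: "i \<in> {1..4}" "j \<in> {1..4}" "k \<in> {1..4}" "l \<in> {1..4}" "distinct [i, j, k, l]"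
    and w: "w = (x, y, z)"
    and h: "(h 1)\<^sup>2 + (h 2)\<^sup>2 + (h 3)\<^sup>2 + (h 4)\<^sup>2 + h 1 * h 2 * h 3 * h 4 =
      x * (h 1 * h 2 + h 3 * h 4) + y * (h 2 * h 3 + h 1 * h 4) + z * (h 1 * h 3 + h 2 * h 4)
      + 4 - x\<^sup>2 - y\<^sup>2 - z\<^sup>2 - x * y * z"
  shows "lam w k l = lam w i j" "lam w j l = lam w i k" "lam w j k = lam w i l"
    and "(h i)\<^sup>2 + (h j)\<^sup>2 + (h k)\<^sup>2 + (h l)\<^sup>2 + h i * h j * h k * h l =
      lam w i j * (h i * h j + h k * h l) + lam w i k * (h i * h k + h j * h l)
      + lam w i l * (h i * h l + h j * h k)
      + 4 - (lam w i j)\<^sup>2 - (lam w i k)\<^sup>2 - (lam w i l)\<^sup>2 - lam w i j * lam w i k * lam w i l"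
proof -
  have lam: "lam w 1 2 = x" "lam w 1 3 = z" "lam w 1 4 = y" "lam w 2 1 = x" "lam w 2 3 = y"
    "lam w 2 4 = z" "lam w 3 1 = z" "lam w 3 2 = y" "lam w 3 4 = x" "lam w 4 1 = y"
    "lam w 4 2 = z" "lam w 4 3 = x"
    unfolding w lam_def by (simp_all add: doubleton_eq_iff)
  have "(i, j, k, l) \<in> {
    (1, 2, 3, 4), (1, 2, 4, 3), (1, 3, 2, 4), (1, 3, 4, 2), (1, 4, 2, 3), (1, 4, 3, 2), (2, 1,
    3, 4), (2, 1, 4, 3), (2, 3, 1, 4), (2, 3, 4, 1), (2, 4, 1, 3), (2, 4, 3, 1), (3, 1, 2, 4),
    (3, 1, 4, 2), (3, 2, 1, 4), (3, 2, 4, 1), (3, 4, 1, 2), (3, 4, 2, 1), (4, 1, 2, 3), (4, 1,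
    3, 2), (4, 2, 1, 3), (4, 2, 3, 1), (4, 3, 1, 2), (4, 3, 2, 1)}"
    using col unfolding colors by (elim disjE; simp)
  then have "lam w k l = lam w i j \<and> lam w j l = lam w i k \<and> lam w j k = lam w i l \<and>
    (h i)\<^sup>2 + (h j)\<^sup>2 + (h k)\<^sup>2 + (h l)\<^sup>2 + h i * h j * h k * h l -
      (lam w i j * (h i * h j + h k * h l) + lam w i k * (h i * h k + h j * h l)
      + lam w i l * (h i * h l + h j * h k)
      + 4 - (lam w i j)\<^sup>2 - (lam w i k)\<^sup>2 - (lam w i l)\<^sup>2 - lam w i j * lam w i k * lam w i l) =
    (h 1)\<^sup>2 + (h 2)\<^sup>2 + (h 3)\<^sup>2 + (h 4)\<^sup>2 + h 1 * h 2 * h 3 * h 4 -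
      (x * (h 1 * h 2 + h 3 * h 4) + y * (h 2 * h 3 + h 1 * h 4) + z * (h 1 * h 3 + h 2 * h 4)
      + 4 - x\<^sup>2 - y\<^sup>2 - z\<^sup>2 - x * y * z)"
    unfolding insert_iff empty_iff prod.inject
    by (elim disjE conjE FalseE; hypsubst; simp only: lam; simp add: algebra_simps)
  then show "lam w k l = lam w i j" "lam w j l = lam w i k" "lam w j k = lam w i l"
    and "(h i)\<^sup>2 + (h j)\<^sup>2 + (h k)\<^sup>2 + (h l)\<^sup>2 + h i * h j * h k * h l =
      lam w i j * (h i * h j + h k * h l) + lam w i k * (h i * h k + h j * h l)
      + lam w i l * (h i * h l + h j * h k)
      + 4 - (lam w i j)\<^sup>2 - (lam w i k)\<^sup>2 - (lam w i l)\<^sup>2 - lam w i j * lam w i k * lam w i l"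
    unfolding h diff_self right_minus_eq by blast+
qed

text \<open>Regions are themselves sets (of curves), and automation would take their equality apart by
  extensionality. So the regions are taken from an arbitrary type, and only the incidence
  structure of the tree is retained.\<close>

locale Markoff_tree =
  fixes V :: "'a set set" and F :: "'a set set" and col :: "'a \<Rightarrow> nat" and w :: parameter
    and val :: "'a \<Rightarrow> complex" and fval :: "'a set \<Rightarrow> complex" and sg :: "'a set \<Rightarrow> complex"
  assumes card_vertex: "v \<in> V \<Longrightarrow> card v = 4"
    and card_face: "xi \<in> F \<Longrightarrow> card xi = 2"
    and face_subset: "v \<in> V \<Longrightarrow> xi \<subseteq> v \<Longrightarrow> card xi = 2 \<Longrightarrow> xi \<in> F"
    and two_vertices: "v \<in> V \<Longrightarrow> e \<subseteq> v \<Longrightarrow> card e = 3 \<Longrightarrow> card {u \<in> V. e \<subseteq> u} = 2"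
    and connected: "connected_in V V"
    and acyclic: "3 \<le> length us \<Longrightarrow> distinct us \<Longrightarrow>
      \<exists>i<length us. \<not> adj_in V (us ! i) (us ! ((i + 1) mod length us))"
    and face_vertices: "xi \<in> F \<Longrightarrow> {v \<in> V. xi \<subseteq> v} \<noteq> {}"
    and face_connected: "xi \<in> F \<Longrightarrow> connected_in V {v \<in> V. xi \<subseteq> v}"
    and inj_col: "v \<in> V \<Longrightarrow> inj_on col v"
    and col_range: "v \<in> V \<Longrightarrow> A \<in> v \<Longrightarrow> col A \<in> {1..4}"
    and vertex_value: "{A1, A2, A3, A4} \<in> V \<Longrightarrow> col A1 = 1 \<Longrightarrow> col A2 = 2 \<Longrightarrow> col A3 = 3 \<Longrightarrow>
      col A4 = 4 \<Longrightarrow> w = (x, y, z) \<Longrightarrow>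
      (val A1)\<^sup>2 + (val A2)\<^sup>2 + (val A3)\<^sup>2 + (val A4)\<^sup>2 + val A1 * val A2 * val A3 * val A4 =
      x * (val A1 * val A2 + val A3 * val A4) + y * (val A2 * val A3 + val A1 * val A4)
      + z * (val A1 * val A3 + val A2 * val A4) + 4 - x\<^sup>2 - y\<^sup>2 - z\<^sup>2 - x * y * z"
    and edge_value: "{A, B, C, D} \<in> V \<Longrightarrow> {A, B, C, D'} \<in> V \<Longrightarrow> distinct [A, B, C, D, D'] \<Longrightarrow>
      val D + val D' = lam w (col A) (col D) * val A + lam w (col B) (col D) * val B
        + lam w (col C) (col D) * val C - val A * val B * val C"
    and face_value: "{A, B} \<in> F \<Longrightarrow> val A * val B = lam w (col A) (col B) + fval {A, B}"
    and sg: "{A, B} \<in> F \<Longrightarrow> k \<in> {1..4} - {col A, col B} \<Longrightarrow> sg {A, B} =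
      ((val A)\<^sup>2 + (val B)\<^sup>2 + (lam w (col A) (col B))\<^sup>2 - val A * val B * lam w (col A) (col B) - 4) *
      ((lam w (col A) k)\<^sup>2 + (lam w (col B) k)\<^sup>2 + (fval {A, B})\<^sup>2
        - lam w (col A) k * lam w (col B) k * fval {A, B} - 4)"
begin

abbreviation adj :: "'a set \<Rightarrow> 'a set \<Rightarrow> bool" where "adj \<equiv> adj_in V"

abbreviation M :: real where "M \<equiv> max_norm w"

definition small :: "real \<Rightarrow> 'a set set" where
  "small K = {xi \<in> F. (\<exists>A\<in>xi. norm (val A) < K) \<and> norm (fval xi) < K\<^sup>2 + M}"

section \<open>Incidence in the tree and size estimates for the values\<close>

lemma finite_vertex: "v \<in> V \<Longrightarrow> finite v"
  using card_vertex by (metis card.infinite zero_neq_numeral)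

lemma face_subset_vertex: "v \<in> V \<Longrightarrow> A \<in> v \<Longrightarrow> B \<in> v \<Longrightarrow> A \<noteq> B \<Longrightarrow> {A, B} \<in> F"
  using face_subset[of v "{A, B}"] by simp

lemma vertexE:
  assumes "v \<in> V" "A \<in> v" "B \<in> v" "A \<noteq> B"
  obtains C D where "v = {A, B, C, D}" "distinct [A, B, C, D]"
proof -
  have "card (v - {A, B}) = 2" using assms card_vertex[OF assms(1)] by (simp add: card_Diff_subset)
  then obtain C D where *: "v - {A, B} = {C, D}" "C \<noteq> D" unfolding card_2_iff by blast
  then have "v = {A, B, C, D}" using assms by blast
  moreover have "C \<notin> {A, B}" "D \<notin> {A, B}" using * by blast+
  ultimately show ?thesis using that[of C D] *(2) assms(4) by auto
qed

lemma faceE: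
  assumes "xi \<in> F"
  obtains A B where "xi = {A, B}" "A \<noteq> B"
  using card_face[OF assms] unfolding card_2_iff by blast

lemma adj_sym: "adj u v \<Longrightarrow> adj v u"
  by (auto simp: adj_in_def Int_commute)

lemma adjE:
  assumes "adj u v"
  obtains D D' where "D \<in> u" "D' \<notin> u" "v = insert D' (u - {D})"
proof -
  have uv: "finite u" "card u = 4" "finite v" "card v = 4" "card (u \<inter> v) = 3"
    using assms finite_vertex card_vertex by (auto simp: adj_in_def)
  have "card (u - v) = 1" "card (v - u) = 1"
    using uv card_Diff_subset_Int[of u v] card_Diff_subset_Int[of v u] by (auto simp: Int_commute)
  then obtain D D' where "u - v = {D}" "v - u = {D'}" by (auto simp: card_1_singleton_iff)
  then show ?thesis using that[of D D'] by blast
qed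

lemma adjI:
  assumes "{A, B, C, D} \<in> V" "{A, B, C, D'} \<in> V" "distinct [A, B, C, D, D']"
  shows "adj {A, B, C, D} {A, B, C, D'}"
proof -
  have "{A, B, C, D} \<inter> {A, B, C, D'} = {A, B, C}" "D \<notin> {A, B, C, D'}" using assms(3) by auto
  then show ?thesis using assms unfolding adj_in_def by auto
qed

lemma edge_vertex_unique:
  assumes "u \<in> V" "card e = 3" "e \<subseteq> u" "v \<in> V" "e \<subseteq> v" "v' \<in> V" "e \<subseteq> v'" "v \<noteq> u" "v' \<noteq> u"
  shows "v = v'"
proof -
  obtain x y where "{u \<in> V. e \<subseteq> u} = {x, y}"
    using two_vertices[OF assms(1,3,2)] unfolding card_2_iff by blast
  then have "u \<in> {x, y}" "v \<in> {x, y}" "v' \<in> {x, y}" using assms by blast+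
  then show ?thesis using assms by auto
qed

text \<open>Triangle inequality, with all coefficients bounded by \<open>M\<close>. The size
  estimates across an edge use the edge relation only in this form, from which the colors have
  disappeared.\<close>

lemma edge_value_norm:
  assumes "{A, B, C, D} \<in> V" "{A, B, C, D'} \<in> V" "distinct [A, B, C, D, D']"
  shows "norm (val A) * norm (val B) * norm (val C)
    - M * (norm (val A) + norm (val B) + norm (val C)) \<le> norm (val D) + norm (val D')"
proof -
  have l: "norm (lam w i j * x) \<le> M * norm x" for i j x
    unfolding norm_mult by (intro mult_right_mono norm_lam_le) auto
  have "val A * val B * val C = lam w (col A) (col D) * val A + lam w (col B) (col D) * val B
    + lam w (col C) (col D) * val C - (val D + val D')"
    using edge_value[OF assms] by simp
  then have "norm (val A * val B * val C) \<le> norm (lam w (col A) (col D) * val A)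
    + norm (lam w (col B) (col D) * val B) + norm (lam w (col C) (col D) * val C)
    + (norm (val D) + norm (val D'))"
    by (metis (no_types) norm_triangle_le norm_triangle_le_diff order_refl add_mono)
  then show ?thesis
    using l[of "col A" "col D" "val A"] l[of "col B" "col D" "val B"] l[of "col C" "col D" "val C"]
    by (simp add: norm_mult distrib_left)
qed

lemma small_iff:
  assumes "{A, B} \<in> F"
  shows "{A, B} \<in> small K \<longleftrightarrow> (norm (val A) < K \<or> norm (val B) < K) \<and>
    norm (val A * val B - lam w (col A) (col B)) < K\<^sup>2 + M"
  using assms face_value[OF assms] by (auto simp: small_def)

text \<open>As the coefficients are at most \<open>M\<close>, the bound \<open>K^2 + M\<close> on
  the face value lies between two bounds on the product: below \<open>K^2 + 2 * M\<close> is
  necessary, and below \<open>K^2\<close> suffices (\<open>smallI\<close>).\<close>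

lemma small_product:
  assumes "{A, B} \<in> small K"
  shows "norm (val A) * norm (val B) < K\<^sup>2 + 2 * M"
proof -
  have "{A, B} \<in> F" using assms by (simp add: small_def)
  then have "norm (val A * val B - lam w (col A) (col B)) < K\<^sup>2 + M"
    using assms small_iff by blast
  then show ?thesis
    using norm_lam_le[of w "col A" "col B"]
      norm_triangle_ineq2[of "val A * val B" "lam w (col A) (col B)"] by (simp add: norm_mult)
qed

lemma smallI:
  assumes "{A, B} \<in> F" "norm (val A) < K \<or> norm (val B) < K"
    and "norm (val A) * norm (val B) < K\<^sup>2"
  shows "{A, B} \<in> small K"
  using assms norm_lam_le[of w "col A" "col B"]
    norm_triangle_ineq4[of "val A * val B" "lam w (col A) (col B)"]
  unfolding small_iff[OF assms(1)] by (simp add: norm_mult)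

lemma small_mono:
  assumes "0 < K" "K \<le> L"
  shows "small K \<subseteq> small L"
proof -
  have "K\<^sup>2 \<le> L\<^sup>2" using assms by (intro power_mono) auto
  then show ?thesis using assms(2) unfolding small_def by (fastforce intro: less_le_trans)
qed

subsection \<open>Forks and paths\<close>

definition thin :: "real \<Rightarrow> 'a set \<Rightarrow> bool" where
  "thin K v \<longleftrightarrow> (\<exists>xi\<in>small K. xi \<subseteq> v)"

text \<open>If both values are at least \<open>K\<close> there is nothing to do; otherwise a product
  below \<open>K^2\<close> would make the face small.\<close>

lemma not_thin_product:
  assumes "v \<in> V" "\<not> thin K v" "0 < K" "A \<in> v" "B \<in> v" "A \<noteq> B"
  shows "K\<^sup>2 \<le> norm (val A) * norm (val B)"
proof (rule ccontr)
  assume *: "\<not> ?thesis"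
  have f: "{A, B} \<in> F" using face_subset_vertex assms by blast
  have "norm (val A) < K \<or> norm (val B) < K"
  proof (rule ccontr)
    assume "\<not> ?thesis"
    then have "K * K \<le> norm (val A) * norm (val B)" using assms(3) by (intro mult_mono) auto
    then show False using * by (simp add: power2_eq_square)
  qed
  then have "{A, B} \<in> small K" using smallI[OF f] * by simp
  moreover have "{A, B} \<subseteq> v" using assms(4,5) by simp
  ultimately show False using assms(2) unfolding thin_def by metis
qed

text \<open>The edge from \<open>u\<close> to \<open>v\<close> may be oriented towards \<open>v\<close>; ties may be oriented both ways.\<close>

definition falls :: "'a set \<Rightarrow> 'a set \<Rightarrow> bool" where
  "falls u v \<longleftrightarrow> (\<forall>D\<in>u - v. \<forall>D'\<in>v - u. norm (val D') \<le> norm (val D))"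

lemma falls_cases:
  assumes "adj u v"
  shows "falls u v \<or> falls v u"
proof -
  obtain D D' where "D \<in> u" "D' \<notin> u" "v = insert D' (u - {D})" using assms by (rule adjE)
  then show ?thesis by (auto simp: falls_def)
qed

text \<open>The regions \<open>C\<close> and \<open>D\<close> removed along the two edges differ,
  because a triple lies in only two vertices. The edge relations of the two triples then share
  \<open>A\<close> and \<open>B\<close>, and \<open>fork_arith\<close> refutes them
  together.\<close>

lemma fork:
  assumes K: "2 + M \<le> K" and u1: "adj v u1" and u2: "adj v u2" and "u1 \<noteq> u2"
    and thick: "\<not> thin K v" and falls: "falls v u1" "falls v u2"
  shows False
proof -
  obtain D D' where D: "D \<in> v" "D' \<notin> v" "u1 = insert D' (v - {D})" using u1 by (rule adjE)
  obtain C C' where C: "C \<in> v" "C' \<notin> v" "u2 = insert C' (v - {C})" using u2 by (rule adjE)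
  have v: "v \<in> V" "u1 \<in> V" "u2 \<in> V" using u1 u2 by (auto simp: adj_in_def)
  have "C \<noteq> D"
  proof
    assume "C = D"
    have e: "card (v \<inter> u1) = 3" using u1 by (simp add: adj_in_def)
    have "v \<inter> u1 \<subseteq> u2" using D C \<open>C = D\<close> by auto
    then have "u1 = u2"
      using v D C u1 u2 by (intro edge_vertex_unique[OF v(1) e]) (auto simp: adj_in_def)
    with \<open>u1 \<noteq> u2\<close> show False ..
  qed
  then obtain A B where AB: "v = {C, D, A, B}" "distinct [C, D, A, B]"
    using vertexE[OF v(1) C(1) D(1)] by blast
  have eq: "{A, B, C, D} = v" "{A, B, D, C} = v" "{A, B, C, D'} = u1" "{A, B, D, C'} = u2"
  proof -
    have "C \<notin> {A, B, D}" "D \<notin> {A, B, C}" using AB(2) by auto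
    then show "{A, B, C, D} = v" "{A, B, D, C} = v" "{A, B, C, D'} = u1" "{A, B, D, C'} = u2"
      unfolding C(3) D(3) AB(1) by blast+
  qed
  note * = v(1)[folded eq(1)] v(1)[folded eq(2)] v(2)[folded eq(3)] v(3)[folded eq(4)]
  have "norm (val D') \<le> norm (val D)" "norm (val C') \<le> norm (val C)"
    using falls C D unfolding falls_def by auto
  then have d: "norm (val A) * norm (val B) * norm (val C)
      - M * (norm (val A) + norm (val B) + norm (val C)) \<le> 2 * norm (val D)"
    and c: "norm (val A) * norm (val B) * norm (val D)
      - M * (norm (val A) + norm (val B) + norm (val D)) \<le> 2 * norm (val C)"
    using edge_value_norm[OF *(1,3)] edge_value_norm[OF *(2,4)] AB C(2) D(2) by auto
  have p: "K\<^sup>2 \<le> norm (val X) * norm (val Y)" if "X \<in> v" "Y \<in> v" "X \<noteq> Y" for X Y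
    using not_thin_product[OF v(1) thick] that K max_norm_nonneg[of w] by simp
  show False
    by (rule fork_arith[OF max_norm_nonneg[of w] K _ _ _ _ _ _ _ _ _ d c])
      (use AB in \<open>auto intro!: p\<close>)
qed

text \<open>The face \<open>xi\<close> is lost on the way to \<open>v\<close>, so it contains the
  replaced region \<open>D\<close>. The other three regions survive in \<open>v\<close>, where their
  products are large, and \<open>rise_arith\<close> applies.\<close>

lemma rise:
  assumes K: "2 + M \<le> K" and uv: "adj u v" and xi: "xi \<in> small (K + 1/4)"
    and sub: "xi \<subseteq> u" "\<not> xi \<subseteq> v" and thick: "\<not> thin K v" and falls: "falls u v"
  shows False
proof -
  obtain D D' where D: "D \<in> u" "D' \<notin> u" "v = insert D' (u - {D})" using uv by (rule adjE)
  have v: "u \<in> V" "v \<in> V" using uv by (auto simp: adj_in_def)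
  have "D \<in> xi" using sub D by auto
  have f: "xi \<in> F" using xi by (simp add: small_def)
  then obtain A where A: "xi = {A, D}" "A \<noteq> D"
    using \<open>D \<in> xi\<close> by (auto elim!: faceE simp: insert_commute)
  then obtain B C where BC: "u = {A, D, B, C}" "distinct [A, D, B, C]"
    using vertexE[OF v(1), of A D] sub D(1) by auto
  have "{A, B, C, D} = u" "{A, B, C, D'} = v" using BC D by auto
  then have e: "norm (val A) * norm (val B) * norm (val C)
      - M * (norm (val A) + norm (val B) + norm (val C)) \<le> norm (val D) + norm (val D')"
    using v BC D(2) by (intro edge_value_norm) auto
  moreover have "norm (val D') \<le> norm (val D)" using falls D unfolding falls_def by auto
  ultimately have d: "norm (val A) * norm (val B) * norm (val C)
      - M * (norm (val A) + norm (val B) + norm (val C)) \<le> 2 * norm (val D)" by simp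
  have p: "K\<^sup>2 \<le> norm (val X) * norm (val Y)" if "X \<in> v" "Y \<in> v" "X \<noteq> Y" for X Y
    using not_thin_product[OF v(2) thick] that K max_norm_nonneg[of w] by simp
  have s: "norm (val A) < K + 1/4 \<or> norm (val D) < K + 1/4"
    using xi small_iff f unfolding A(1) by blast
  have s': "norm (val A) * norm (val D) < (K + 1/4)\<^sup>2 + 2 * M"
    using small_product xi unfolding A(1) .
  show False
    by (rule rise_arith[OF max_norm_nonneg[of w] K _ _ _ _ _ _ _ s s' d])
      (use BC D in \<open>auto intro!: p\<close>)
qed

text \<open>All avoidance properties come from minimal length: a later visit to \<open>X\<close> or
  an earlier one to \<open>Y\<close> would give a shorter path, and so would cutting out a step
  back.\<close>

lemma shortest_path:
  assumes X: "X \<subseteq> V" "X \<noteq> {}" and Y: "Y \<subseteq> V" "Y \<noteq> {}"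
  obtains f n where "f 0 \<in> X" "f n \<in> Y" "\<And>i. i < n \<Longrightarrow> adj (f i) (f (Suc i))"
    "\<And>i. 0 < i \<Longrightarrow> i \<le> n \<Longrightarrow> f i \<notin> X" "\<And>i. i < n \<Longrightarrow> f i \<notin> Y"
    "\<And>i. Suc (Suc i) \<le> n \<Longrightarrow> f i \<noteq> f (Suc (Suc i))"
proof -
  define R where "R = {(a, b). a \<in> V \<and> b \<in> V \<and> adj a b}"
  define P where "P n \<longleftrightarrow> (\<exists>x\<in>X. \<exists>y\<in>Y. (x, y) \<in> R ^^ n)" for n
  obtain x y where xy: "x \<in> X" "y \<in> Y" using X Y by blast
  then have "(x, y) \<in> R\<^sup>*" using connected X Y unfolding connected_in_def R_def by blast
  then obtain k where "(x, y) \<in> R ^^ k" using rtrancl_imp_relpow by blast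
  then have "\<exists>n. P n" using xy unfolding P_def by blast
  define n where "n = (LEAST n. P n)"
  have "P n" unfolding n_def using \<open>\<exists>n. P n\<close> by (rule LeastI_ex)
  have least: "n \<le> k" if "P k" for k using that unfolding n_def by (rule Least_le)
  obtain f where f: "f 0 \<in> X" "f n \<in> Y" "\<And>i. i < n \<Longrightarrow> (f i, f (Suc i)) \<in> R"
    using \<open>P n\<close> unfolding P_def relpow_fun_conv by blast
  have sub: "(f i, f (i + k)) \<in> R ^^ k" if "i + k \<le> n" for i k
    unfolding relpow_fun_conv by (rule exI[of _ "\<lambda>j. f (i + j)"]) (use that f(3) in auto)
  show ?thesis
  proof (rule that[of f n])
    show "adj (f i) (f (Suc i))" if "i < n" for i using f(3)[OF that] by (simp add: R_def)
    show "f i \<notin> X" if "0 < i" "i \<le> n" for i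
    proof
      assume "f i \<in> X"
      moreover have "(f i, f n) \<in> R ^^ (n - i)" using sub[of i "n - i"] that by simp
      ultimately have "P (n - i)" using f(2) unfolding P_def by blast
      then show False using least[of "n - i"] that by linarith
    qed
    show "f i \<notin> Y" if "i < n" for i
    proof
      assume "f i \<in> Y"
      moreover have "(f 0, f i) \<in> R ^^ i" using sub[of 0 i] that by simp
      ultimately have "P i" using f(1) unfolding P_def by blast
      then show False using least[of i] that by linarith
    qed
    show "f i \<noteq> f (Suc (Suc i))" if "Suc (Suc i) \<le> n" for i
    proof
      assume "f i = f (Suc (Suc i))"
      moreover have "(f 0, f i) \<in> R ^^ i" using sub[of 0 i] that by simp
      moreover have "(f (Suc (Suc i)), f n) \<in> R ^^ (n - Suc (Suc i))"
        using sub[of "Suc (Suc i)" "n - Suc (Suc i)"] unfolding le_add_diff_inverse[OF that] by simp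
      ultimately have "(f 0, f n) \<in> R ^^ (i + (n - Suc (Suc i)))"
        unfolding relpow_add by auto
      then have "P (i + (n - Suc (Suc i)))" using f(1,2) unfolding P_def by blast
      then show False using least[of "i + (n - Suc (Suc i))"] that by linarith
    qed
  qed (use f in auto)
qed

text \<open>Take a return of the least possible length \<open>k\<close>. Adjacency excludes
  \<open>k = 1\<close>, the absence of backtracking excludes \<open>k = 2\<close>, and by minimality
  the \<open>k\<close> vertices passed are distinct, so they form a cycle in the tree.\<close>

lemma walk_inj:
  assumes adj: "\<And>i. adj (f i) (f (Suc i))" and nb: "\<And>i. f i \<noteq> f (Suc (Suc i))"
  shows "inj (f :: nat \<Rightarrow> 'a set)"
proof (rule ccontr)
  define P where "P k \<longleftrightarrow> 0 < k \<and> (\<exists>m. f (m + k) = f m)" for k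
  assume "\<not> inj f"
  then obtain i j where "i \<noteq> j" "f i = f j" unfolding inj_def by blast
  then obtain i j where ij: "i < j" "f i = f j" by (cases "i < j") (auto simp: linorder_neq_iff)
  then have "P (j - i)" unfolding P_def by (intro conjI exI[of _ i]) auto
  define k where "k = (LEAST k. P k)"
  have "P k" unfolding k_def using \<open>P (j - i)\<close> by (rule LeastI)
  have least: "k \<le> l" if "P l" for l using that unfolding k_def by (rule Least_le)
  obtain m where m: "f (m + k) = f m" "0 < k" using \<open>P k\<close> unfolding P_def by blast
  have "k \<noteq> 1"
  proof
    assume "k = 1"
    then have "f (Suc m) = f m" using m(1) by simp
    moreover have "f m \<noteq> f (Suc m)" using adj[of m] unfolding adj_in_def by blast
    ultimately show False by simp
  qed
  moreover have "k \<noteq> 2"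
  proof
    assume "k = 2"
    then have "f (Suc (Suc m)) = f m" using m(1) by simp
    then show False using nb[of m] by simp
  qed
  ultimately have k: "3 \<le> k" using m(2) by linarith
  define us where "us = map f [m..<m + k]"
  have "distinct us"
    unfolding us_def distinct_map
  proof (intro conjI inj_onI)
    have *: False if "c < d" "d < c + k" "f d = f c" for c d
    proof -
      have "P (d - c)" unfolding P_def using that by (intro conjI exI[of _ c]) auto
      then show False using least[of "d - c"] that by linarith
    qed
    fix a b assume ab: "a \<in> set [m..<m + k]" "b \<in> set [m..<m + k]" "f a = f b"
    have "\<not> a < b" "\<not> b < a"
      using *[of a b, OF _ _ ab(3)[symmetric]] *[of b a, OF _ _ ab(3)] ab(1,2) by auto
    then show "a = b" by simp
  qed simp
  moreover have "adj (us ! i) (us ! ((i + 1) mod length us))" if "i < length us" for i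
  proof (cases "Suc i = k")
    case True
    then have "f (Suc (m + i)) = f m" using m(1) by (metis add_Suc_right)
    then show ?thesis using adj[of "m + i"] True m(2) by (simp add: us_def)
  next
    case False
    then show ?thesis using adj[of "m + i"] that by (simp add: us_def)
  qed
  moreover have "length us = k" by (simp add: us_def)
  ultimately show False using acyclic[of us] k by blast
qed

text \<open>Along a path between two thin ends whose inner vertices are not thin, the first edge falls
  towards the start; as no inner vertex is a fork, so do all edges, up to the last one.\<close>

lemma no_path_between_thin:
  assumes K: "2 + M \<le> K" and n: "0 < n"
    and adj: "\<And>i. i < n \<Longrightarrow> adj (f i) (f (Suc i))"
    and nb: "\<And>i. Suc (Suc i) \<le> n \<Longrightarrow> f i \<noteq> f (Suc (Suc i))"
    and thick: "\<And>i. 0 < i \<Longrightarrow> i < n \<Longrightarrow> \<not> thin K (f i)" "\<not> thin K (f 1)" "\<not> thin K (f (n - 1))"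
    and xi: "xi \<in> small (K + 1/4)" "xi \<subseteq> f 0" "\<not> xi \<subseteq> f 1"
    and eta: "eta \<in> small (K + 1/4)" "eta \<subseteq> f n" "\<not> eta \<subseteq> f (n - 1)"
  shows False
proof -
  have "i < n \<Longrightarrow> falls (f (Suc i)) (f i)" for i
  proof (induction i)
    case 0
    then show ?case using rise[OF K adj[of 0] xi(1)] xi thick(2) falls_cases[OF adj[of 0]] by auto
  next
    case (Suc i)
    then have "\<not> falls (f (Suc i)) (f (Suc (Suc i)))"
      using fork[OF K adj_sym[OF adj[of i]] adj[of "Suc i"]] nb[of i] thick(1)[of "Suc i"] by auto
    then show ?case using falls_cases[OF adj[of "Suc i"]] Suc.prems by auto
  qed
  \<comment> \<open>The last edge would fall away from \<open>eta\<close>, and \<open>rise\<close>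
    forbids this just as it forbade the first edge to fall away from \<open>xi\<close>.\<close>
  from this[of "n - 1"] have "falls (f n) (f (n - 1))" using n by simp
  moreover have "adj (f n) (f (n - 1))" using adj[of "n - 1"] n adj_sym by simp
  ultimately show False using rise[OF K _ eta thick(3)] by blast
qed

lemma small_face: "xi \<in> small K \<Longrightarrow> xi \<in> F"
  by (simp add: small_def)

text \<open>Consider a shortest path from the vertices around \<open>xi\<close> to the thin
  vertices; length two or more contradicts \<open>no_path_between_thin\<close>.\<close>

lemma small_face_near_thin:
  assumes K: "2 + M \<le> K" and ne: "small K \<noteq> {}"
    and xi: "xi \<in> small (K + 1/4)"
  obtains u v where "u \<in> V" "xi \<subseteq> u" "v \<in> V" "thin K v"
    "u = v \<or> adj u v \<and> \<not> thin K u"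
proof -
  have K0: "0 < K" using K max_norm_nonneg[of w] by simp
  have X: "{v \<in> V. xi \<subseteq> v} \<noteq> {}" "{v \<in> V. xi \<subseteq> v} \<subseteq> V"
    using face_vertices[OF small_face[OF xi]] by auto
  obtain eta0 where "eta0 \<in> small K" using ne by blast
  moreover from this obtain v0 where "v0 \<in> V" "eta0 \<subseteq> v0" using face_vertices[OF small_face] by blast
  ultimately have Y: "{v \<in> V. thin K v} \<noteq> {}" unfolding thin_def by blast
  obtain f n where f: "f 0 \<in> {v \<in> V. xi \<subseteq> v}" "f n \<in> {v \<in> V. thin K v}"
    "\<And>i. i < n \<Longrightarrow> adj (f i) (f (Suc i))"
    "\<And>i. 0 < i \<Longrightarrow> i \<le> n \<Longrightarrow> f i \<notin> {v \<in> V. xi \<subseteq> v}"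
    "\<And>i. i < n \<Longrightarrow> f i \<notin> {v \<in> V. thin K v}"
    "\<And>i. Suc (Suc i) \<le> n \<Longrightarrow> f i \<noteq> f (Suc (Suc i))"
    using shortest_path[OF X(2,1) _ Y] by blast
  have fv: "f i \<in> V" if "i < n" for i using f(3)[OF that] by (simp add: adj_in_def)
  consider "n = 0" | "n = 1" | "2 \<le> n" by linarith
  then show ?thesis
  proof cases
    case 1
    then show ?thesis using that[of "f 0" "f 0"] f(1,2) by auto
  next
    case 2
    then show ?thesis using that[of "f 0" "f 1"] f(1,2) f(3,5)[of 0] by auto
  next
    case 3
    \<comment> \<open>Here \<open>2 \<le> n\<close> matters: for \<open>n = 1\<close> the vertex
      \<open>f 1\<close> is the thin end itself, and distance one remains possible.\<close>
    have thick: "\<not> thin K (f i)" if "i < n" for i using f(5)[OF that] fv[OF that] by blast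
    obtain eta where eta: "eta \<in> small K" "eta \<subseteq> f n" using f(2) by (auto simp: thin_def)
    have False
    proof (rule no_path_between_thin[where f = f and n = n, OF K _ f(3) f(6) _ _ _ xi])
      show "eta \<in> small (K + 1/4)" using eta small_mono[OF K0, of "K + 1/4"] by auto
      show "\<not> eta \<subseteq> f (n - 1)" using eta(1) thick[of "n - 1"] 3 unfolding thin_def by auto
      show "\<not> xi \<subseteq> f 1" using f(4)[of 1] fv[of 1] 3 by simp
    qed (use 3 thick eta f(1) in auto)
    then show ?thesis ..
  qed
qed

text \<open>Without small faces for \<open>K\<close> no vertex is thin, so a shortest path between
  the two lines of vertices cannot have positive length.\<close>

lemma small_faces_meet:
  assumes K: "2 + M \<le> K" and empty: "small K = {}"
    and xi: "xi \<in> small (K + 1/4)" and eta: "eta \<in> small (K + 1/4)"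
  obtains v where "v \<in> V" "xi \<subseteq> v" "eta \<subseteq> v"
proof -
  have X: "{v \<in> V. xi \<subseteq> v} \<noteq> {}" "{v \<in> V. xi \<subseteq> v} \<subseteq> V"
    and Y: "{v \<in> V. eta \<subseteq> v} \<noteq> {}" "{v \<in> V. eta \<subseteq> v} \<subseteq> V"
    using face_vertices[OF small_face[OF xi]] face_vertices[OF small_face[OF eta]] by auto
  obtain f n where f: "f 0 \<in> {v \<in> V. xi \<subseteq> v}" "f n \<in> {v \<in> V. eta \<subseteq> v}"
    "\<And>i. i < n \<Longrightarrow> adj (f i) (f (Suc i))"
    "\<And>i. 0 < i \<Longrightarrow> i \<le> n \<Longrightarrow> f i \<notin> {v \<in> V. xi \<subseteq> v}"
    "\<And>i. i < n \<Longrightarrow> f i \<notin> {v \<in> V. eta \<subseteq> v}"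
    "\<And>i. Suc (Suc i) \<le> n \<Longrightarrow> f i \<noteq> f (Suc (Suc i))"
    using shortest_path[OF X(2,1) Y(2,1)] by blast
  have fv: "f i \<in> V" if "i \<le> n" for i
    using f(2) f(3)[of i] that by (cases "i = n") (auto simp: adj_in_def)
  have thick: "\<not> thin K v" for v using empty by (simp add: thin_def)
  have "n = 0"
  proof (rule ccontr)
    assume "n \<noteq> 0"
    show False
    proof (rule no_path_between_thin[where f = f and n = n, OF K _ f(3) f(6) _ _ _ xi])
      show "\<not> eta \<subseteq> f (n - 1)" using f(5)[of "n - 1"] fv[of "n - 1"] \<open>n \<noteq> 0\<close> by simp
      show "\<not> xi \<subseteq> f 1" using f(4)[of 1] fv[of 1] \<open>n \<noteq> 0\<close> by simp
    qed (use \<open>n \<noteq> 0\<close> thick eta f(1,2) in auto)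
  qed
  then show ?thesis using that[of "f 0"] f(1,2) by auto
qed

subsection \<open>Regions around a face\<close>

text \<open>The vertices around a face form a line; a ray lists the regions met along one half of it.\<close>

definition ray :: "'a \<Rightarrow> 'a \<Rightarrow> (nat \<Rightarrow> 'a) \<Rightarrow> bool" where
  "ray A B r \<longleftrightarrow> (\<forall>n. {A, B, r n, r (Suc n)} \<in> V \<and>
     distinct [A, B, r n, r (Suc n), r (Suc (Suc n))])"

lemma rayD:
  assumes "ray A B r"
  shows "{A, B, r n, r (Suc n)} \<in> V" "distinct [A, B, r n, r (Suc n), r (Suc (Suc n))]"
  using assms unfolding ray_def by auto

lemma other_vertex:
  assumes "{A, B, C, D} \<in> V" "distinct [A, B, C, D]"
  shows "\<exists>E. {A, B, D, E} \<in> V \<and> distinct [A, B, C, D, E]"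
proof -
  have "card {v \<in> V. {A, B, D} \<subseteq> v} = 2"
    by (rule two_vertices[OF assms(1)]) (use assms(2) in auto)
  then obtain x y where xy: "{v \<in> V. {A, B, D} \<subseteq> v} = {x, y}" "x \<noteq> y" unfolding card_2_iff by blast
  then obtain v where "v \<in> {x, y}" "v \<noteq> {A, B, C, D}" by (cases "x = {A, B, C, D}") auto
  then have v: "v \<in> V" "{A, B, D} \<subseteq> v" "v \<noteq> {A, B, C, D}" using xy(1) by blast+
  then obtain X Y where XY: "v = {A, B, X, Y}" "distinct [A, B, X, Y]"
    using vertexE[of v A B] assms(2) by auto
  then have "D = X \<or> D = Y" using v(2) assms(2) by auto
  then obtain E where E: "v = {A, B, D, E}" "E \<notin> {A, B, D}"
  proof
    assume "D = X" then show ?thesis using that[of Y] XY by auto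
  next
    assume "D = Y" then show ?thesis using that[of X] XY by auto
  qed
  then have "E \<noteq> C" using v(3) by auto
  then show ?thesis using E v(1) assms(2) by (intro exI[of _ E]) auto
qed

text \<open>Dependent choice runs over pairs of consecutive regions: the region just left must be
  remembered so that the ray does not turn back.\<close>

lemma ray_exists:
  assumes "{A, B, C, D} \<in> V" "distinct [A, B, C, D]"
  obtains r where "ray A B r" "r 0 = C" "r 1 = D"
proof -
  define P where "P p \<longleftrightarrow> {A, B, fst p, snd p} \<in> V \<and> distinct [A, B, fst p, snd p]"
    for p :: "'a \<times> 'a"
  define Q where "Q p q \<longleftrightarrow> fst q = snd p \<and> snd q \<noteq> fst p" for p q :: "'a \<times> 'a"
  have "\<exists>g. \<forall>n. (P (g n) \<and> (n = 0 \<longrightarrow> g n = (C, D))) \<and> Q (g n) (g (Suc n))"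
  proof (rule dependent_nat_choice)
    show "\<exists>p. P p \<and> (0 = (0::nat) \<longrightarrow> p = (C, D))" using assms by (auto simp: P_def)
    fix p n assume "P p \<and> (n = (0::nat) \<longrightarrow> p = (C, D))"
    then obtain E where "{A, B, snd p, E} \<in> V" "distinct [A, B, fst p, snd p, E]"
      using other_vertex[of A B "fst p" "snd p"] unfolding P_def by blast
    then show "\<exists>q. (P q \<and> (Suc n = 0 \<longrightarrow> q = (C, D))) \<and> Q p q"
      unfolding P_def Q_def by (intro exI[of _ "(snd p, E)"]) auto
  qed
  then obtain g where g: "g 0 = (C, D)" "\<And>n. P (g n)" "\<And>n. Q (g n) (g (Suc n))" by blast
  have s: "fst (g (Suc n)) = snd (g n)" for n using g(3) by (simp add: Q_def)
  have "ray A B (\<lambda>n. fst (g n))"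
    unfolding ray_def
  proof
    fix n
    show "{A, B, fst (g n), fst (g (Suc n))} \<in> V \<and>
      distinct [A, B, fst (g n), fst (g (Suc n)), fst (g (Suc (Suc n)))]"
      using g(2)[of n] g(2)[of "Suc n"] g(3)[of n] unfolding s P_def Q_def by auto
  qed
  then show ?thesis using that[of "\<lambda>n. fst (g n)"] g(1) s[of 0] by simp
qed

text \<open>The vertices along a ray form a walk without backtracking and are distinct by
  \<open>walk_inj\<close>; finitely many regions would allow only finitely many of them.\<close>

lemma ray_infinite:
  assumes r: "ray A B r"
  shows "infinite (range r)"
proof
  assume fin: "finite (range r)"
  define f where "f n = {A, B, r n, r (Suc n)}" for n
  have "inj f"
  proof (rule walk_inj)
    show "adj (f i) (f (Suc i))" for i
    proof -
      have "f i = {A, B, r (Suc i), r i}" "f (Suc i) = {A, B, r (Suc i), r (Suc (Suc i))}"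
        by (auto simp: f_def)
      moreover have "{A, B, r (Suc i), r i} \<in> V" using rayD(1)[OF r, of i] by (simp add: insert_commute)
      ultimately show ?thesis using rayD(2)[OF r, of i] rayD(1)[OF r, of "Suc i"]
        by (auto intro!: adjI)
    qed
    show "f i \<noteq> f (Suc (Suc i))" for i
    proof -
      have "r (Suc (Suc i)) \<notin> f i" using rayD(2)[OF r, of i] by (auto simp: f_def)
      then show ?thesis by (auto simp: f_def)
    qed
  qed
  moreover have "range f \<subseteq> Pow (insert A (insert B (range r)))" by (auto simp: f_def)
  then have "finite (range f)" by (rule finite_subset) (use fin in simp)
  ultimately show False using finite_imageD infinite_UNIV_nat by blast
qed

text \<open>An edge that keeps both \<open>A\<close> and \<open>B\<close> leads one step forward or
  one step back along the ray; a step back from the start continues on the other ray.\<close>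

lemma ray_step:
  assumes r: "ray A B r" and r': "ray A B r'" and 0: "r' 0 = r 1" "r' 1 = r 0"
    and y: "y \<in> V" "A \<in> y" "B \<in> y" and adj: "adj {A, B, r n, r (Suc n)} y"
  shows "\<exists>n. y = {A, B, r n, r (Suc n)} \<or> y = {A, B, r' n, r' (Suc n)}"
proof -
  let ?x = "{A, B, r n, r (Suc n)}"
  obtain D D' where D: "D \<in> ?x" "D' \<notin> ?x" "y = insert D' (?x - {D})"
    using adj by (rule adjE)
  have x: "?x \<in> V" "y \<noteq> ?x" using adj by (auto simp: adj_in_def)
  have dist: "distinct [A, B, r n, r (Suc n), r (Suc (Suc n))]" by (rule rayD(2)[OF r])
  have unique: "y = {A, B, E, E'}"
    if "E \<in> {r n, r (Suc n)}" "E \<in> y" "{A, B, E, E'} \<in> V" "E' \<notin> ?x" for E E'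
  proof (rule edge_vertex_unique[OF x(1), of "{A, B, E}"])
    show "card {A, B, E} = 3" using that(1) dist by auto
    show "{A, B, E, E'} \<noteq> ?x" using that(4) by blast
  qed (use that x y in auto)
  have "D \<noteq> A" "D \<noteq> B" using D y by auto
  then consider "D = r n" | "D = r (Suc n)" using D(1) by auto
  then show ?thesis
  proof cases
    case 1
    have "y = {A, B, r (Suc n), r (Suc (Suc n))}"
      by (rule unique) (use 1 D dist rayD(1)[OF r, of "Suc n"] in auto)
    then show ?thesis by blast
  next
    case 2
    have rn: "r n \<in> y" using 2 D dist by auto
    show ?thesis
    proof (cases n)
      case 0
      \<comment> \<open>Both rays have the same vertex at index 0, so the vertex before it on
        \<open>r\<close> has index 1 on \<open>r'\<close>.\<close>
      have "y = {A, B, r' 1, r' 2}"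
      proof (rule unique)
        show "{A, B, r' 1, r' 2} \<in> V" using rayD(1)[OF r', of 1] by (simp add: numeral_2_eq_2)
        show "r' 2 \<notin> ?x" using rayD(2)[OF r', of 0] assms(3,4) 0 by (auto simp: numeral_2_eq_2)
      qed (use rn assms(4) 0 in auto)
      then show ?thesis by (intro exI[of _ 1]) (simp add: numeral_2_eq_2)
    next
      case (Suc m)
      have "y = {A, B, r n, r m}"
      proof (rule unique)
        show "{A, B, r n, r m} \<in> V" using rayD(1)[OF r, of m] Suc by (simp add: insert_commute)
        show "r m \<notin> ?x" using rayD(2)[OF r, of m] Suc by auto
      qed (use rn in auto)
      then show ?thesis using Suc by (intro exI[of _ m]) (simp add: insert_commute)
    qed
  qed
qed

text \<open>The vertices around the face are connected among themselves, and by
  \<open>ray_step\<close> the two rays together are closed under adjacency there.\<close>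

lemma ray_cover:
  assumes r: "ray A B r" and r': "ray A B r'" and 0: "r' 0 = r 1" "r' 1 = r 0"
    and v: "v \<in> V" "A \<in> v" "B \<in> v"
  shows "\<exists>n. v = {A, B, r n, r (Suc n)} \<or> v = {A, B, r' n, r' (Suc n)}"
proof -
  define S where "S = {v \<in> V. {A, B} \<subseteq> v}"
  have b: "{A, B, r 0, r 1} \<in> S" "v \<in> S" using rayD(1)[OF r, of 0] v by (auto simp: S_def)
  have "{A, B} \<in> F"
    using rayD[OF r, of 0] by (intro face_subset_vertex[of "{A, B, r 0, r (Suc 0)}"]) auto
  then have "connected_in V S" unfolding S_def by (rule face_connected)
  then have "({A, B, r 0, r 1}, v) \<in> {(a, b). a \<in> S \<and> b \<in> S \<and> adj a b}\<^sup>*"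
    using b unfolding connected_in_def by blast
  then show ?thesis
  proof (induction rule: rtrancl_induct)
    case base
    then show ?case by (intro exI[of _ 0]) simp
  next
    case (step y z)
    then have z: "z \<in> V" "A \<in> z" "B \<in> z" "adj y z" by (auto simp: S_def)
    obtain n where "y = {A, B, r n, r (Suc n)} \<or> y = {A, B, r' n, r' (Suc n)}" using step.IH by blast
    then show ?case
    proof
      assume "y = {A, B, r n, r (Suc n)}"
      then show ?thesis using ray_step[OF r r' 0 z(1-3)] z(4) by blast
    next
      assume "y = {A, B, r' n, r' (Suc n)}"
      then show ?thesis using ray_step[OF r' r 0(2)[symmetric] 0(1)[symmetric] z(1-3)] z(4) by blast
    qed
  qed
qed

section \<open>The recurrence around a face and its invariant\<close>

lemma vertex_value_any:
  assumes v: "{A, B, C, D} \<in> V" and dist: "distinct [A, B, C, D]"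
  defines "i \<equiv> col A" and "j \<equiv> col B" and "k \<equiv> col C" and "l \<equiv> col D"
  shows "lam w k l = lam w i j" "lam w j l = lam w i k" "lam w j k = lam w i l"
    and "(val A)\<^sup>2 + (val B)\<^sup>2 + (val C)\<^sup>2 + (val D)\<^sup>2 + val A * val B * val C * val D =
      lam w i j * (val A * val B + val C * val D) + lam w i k * (val A * val C + val B * val D)
      + lam w i l * (val A * val D + val B * val C)
      + 4 - (lam w i j)\<^sup>2 - (lam w i k)\<^sup>2 - (lam w i l)\<^sup>2 - lam w i j * lam w i k * lam w i l"
proof -
  let ?v = "{A, B, C, D}"
  define g where "g = inv_into ?v col"
  have inj: "inj_on col ?v" using inj_col[OF v] .
  have "col ` ?v = {1..4}"
  proof (rule card_subset_eq)
    show "col ` ?v \<subseteq> {1..4}" using col_range[OF v] by blast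
    show "card (col ` ?v) = card {1..4::nat}" using card_image[OF inj] card_vertex[OF v] by simp
  qed simp
  \<comment> \<open>The inverse \<open>g\<close> of the coloring lists the regions of the vertex by
    color, which is the order that \<open>vertex_value\<close> expects.\<close>
  then have b: "bij_betw col ?v {1..4}" using inj by (simp add: bij_betw_def)
  have c: "col (g n) = n" if "n \<in> {1..4}" for n
    using bij_betw_inv_into_right[OF b that] by (simp add: g_def)
  have "g ` {1..4} = ?v" using bij_betw_inv_into[OF b] unfolding g_def bij_betw_def by blast
  moreover have "{1..4} = {1, 2, 3, 4::nat}" by auto
  ultimately have "{g 1, g 2, g 3, g 4} = ?v" by simp
  then have g: "{g 1, g 2, g 3, g 4} \<in> V" using v by simp
  obtain x y z where w: "w = (x, y, z)" by (cases w)
  have eq: "(val (g 1))\<^sup>2 + (val (g 2))\<^sup>2 + (val (g 3))\<^sup>2 + (val (g 4))\<^sup>2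
      + val (g 1) * val (g 2) * val (g 3) * val (g 4) =
      x * (val (g 1) * val (g 2) + val (g 3) * val (g 4)) + y * (val (g 2) * val (g 3) + val (g 1) * val (g 4))
      + z * (val (g 1) * val (g 3) + val (g 2) * val (g 4)) + 4 - x\<^sup>2 - y\<^sup>2 - z\<^sup>2 - x * y * z"
    by (rule vertex_value[OF g _ _ _ _ w]) (simp_all add: c)
  have ci: "i \<in> {1..4}" "j \<in> {1..4}" "k \<in> {1..4}" "l \<in> {1..4}"
    unfolding i_def j_def k_def l_def by (rule col_range[OF v]; simp)+
  have cd: "distinct [i, j, k, l]"
    using dist inj unfolding i_def j_def k_def l_def by (auto simp: inj_on_def)
  have gc: "g i = A" "g j = B" "g k = C" "g l = D"
    unfolding g_def i_def j_def k_def l_def by (rule inv_into_f_f[OF inj]; simp)+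
  note P = vertex_relation_permute[where h = "\<lambda>n. val (g n)", OF ci cd w eq]
  show "lam w k l = lam w i j" "lam w j l = lam w i k" "lam w j k = lam w i l" by (fact P)+
  show "(val A)\<^sup>2 + (val B)\<^sup>2 + (val C)\<^sup>2 + (val D)\<^sup>2 + val A * val B * val C * val D =
      lam w i j * (val A * val B + val C * val D) + lam w i k * (val A * val C + val B * val D)
      + lam w i l * (val A * val D + val B * val C)
      + 4 - (lam w i j)\<^sup>2 - (lam w i k)\<^sup>2 - (lam w i l)\<^sup>2 - lam w i j * lam w i k * lam w i l"
    using P(4) unfolding gc .
qed

lemma col_neq: "v \<in> V \<Longrightarrow> X \<in> v \<Longrightarrow> Y \<in> v \<Longrightarrow> X \<noteq> Y \<Longrightarrow> col X \<noteq> col Y"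
  using inj_col unfolding inj_on_def by blast

text \<open>The inhomogeneous term of the recurrence around \<open>{A, B}\<close>; it depends on
  \<open>C\<close> only through its color.\<close>

definition drift :: "'a \<Rightarrow> 'a \<Rightarrow> 'a \<Rightarrow> complex" where
  "drift A B C = lam w (col A) (col C) * val A + lam w (col B) (col C) * val B"

text \<open>Read as an equation in the values at \<open>C\<close> and \<open>D\<close>, the vertex
  relation says that the quadratic expression of the recurrence depends only on the values at
  \<open>A\<close>, \<open>B\<close> and the parameters. With the correction terms of
  \<open>alternating_recurrence_shift\<close> it factors into the two factors of
  \<open>sg {A, B}\<close>.\<close>

lemma face_invariant:
  assumes v: "{A, B, C, D} \<in> V" and dist: "distinct [A, B, C, D]"
  defines "f \<equiv> fval {A, B}" and "s \<equiv> drift A B C" and "t \<equiv> drift A B D"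
  shows "(4 - f\<^sup>2) * ((val C)\<^sup>2 + (val D)\<^sup>2 + f * val C * val D - s * val C - t * val D)
    + s\<^sup>2 + t\<^sup>2 - f * s * t = sg {A, B}"
proof -
  have F: "{A, B} \<in> F" using face_subset_vertex[OF v, of A B] dist by simp
  define x p q where "x = lam w (col A) (col B)" and "p = lam w (col A) (col C)" and "q = lam w (col A) (col D)"
  define a b c d where "a = val A" and "b = val B" and "c = val C" and "d = val D"
  note P = vertex_value_any[OF v dist, folded x_def p_def q_def a_def b_def c_def d_def]
  have f: "f = a * b - x" using face_value[OF F] by (simp add: f_def a_def b_def x_def)
  have st: "s = p * a + q * b" "t = q * a + p * b"
    using P(2,3) by (simp_all add: s_def t_def drift_def a_def b_def p_def q_def)
  have k: "col C \<in> {1..4} - {col A, col B}"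
    using col_range[OF v, of C] col_neq[OF v, of C A] col_neq[OF v, of C B] dist by auto
  have sg: "sg {A, B} = (a\<^sup>2 + b\<^sup>2 + x\<^sup>2 - a * b * x - 4) * (p\<^sup>2 + q\<^sup>2 + f\<^sup>2 - p * q * f - 4)"
    unfolding sg[OF F k] f_def using P(3) by (simp add: a_def b_def x_def p_def)
  have inv: "c\<^sup>2 + d\<^sup>2 + f * c * d - s * c - t * d = 4 - x\<^sup>2 - p\<^sup>2 - q\<^sup>2 - x * p * q - a\<^sup>2 - b\<^sup>2 + x * a * b"
    using P(4) unfolding f st by (simp add: algebra_simps)
  show ?thesis
    unfolding sg c_def[symmetric] d_def[symmetric] inv
    unfolding f st by (simp add: algebra_simps power2_eq_square)
qed

text \<open>Two consecutive vertices share a triple, and the two regions outside it both carry the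
  one color that the triple leaves free.\<close>

lemma ray_colors:
  assumes "ray A B r"
  shows "col (r n) = (if even n then col (r 0) else col (r 1))"
proof -
  have "col (r (Suc (Suc n))) = col (r n)" for n
  proof -
    define S where "S = {col A, col B, col (r (Suc n))}"
    let ?v = "{A, B, r n, r (Suc n)}" and ?u = "{A, B, r (Suc n), r (Suc (Suc n))}"
    note v = rayD(1)[OF assms, of n] and u = rayD(1)[OF assms, of "Suc n"]
    note dist = rayD(2)[OF assms, of n]
    have c: "card S = 3"
      using col_neq[OF v, of A B] col_neq[OF v, of A "r (Suc n)"] col_neq[OF v, of B "r (Suc n)"] dist
      by (simp add: S_def)
    have S: "S \<subseteq> {1..4}" unfolding S_def using col_range[OF v] by blast
    have "card ({1..4} - S) = 1" using c card_Diff_subset[of S "{1..4}"] S finite_subset[OF S] by simp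
    then obtain e where e: "{1..4} - S = {e}" by (auto simp: card_1_singleton_iff)
    have "col (r n) \<in> {1..4} - S" "col (r (Suc (Suc n))) \<in> {1..4} - S"
      using col_range[OF v, of "r n"] col_range[OF u, of "r (Suc (Suc n))"] dist
        col_neq[OF v, of "r n" A] col_neq[OF v, of "r n" B] col_neq[OF v, of "r n" "r (Suc n)"]
        col_neq[OF u, of "r (Suc (Suc n))" A] col_neq[OF u, of "r (Suc (Suc n))" B]
        col_neq[OF u, of "r (Suc (Suc n))" "r (Suc n)"]
      by (auto simp: S_def)
    then show ?thesis unfolding e by simp
  qed
  then have "col (r n) = (if even n then col (r 0) else col (r 1)) \<and>
    col (r (Suc n)) = (if even n then col (r 1) else col (r 0))"
    by (induction n) auto
  then show ?thesis ..
qed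

lemma ray_recurrence:
  assumes r: "ray A B r"
  shows "val (r (Suc (Suc n))) + fval {A, B} * val (r (Suc n)) + val (r n) =
    (if even n then drift A B (r 0) else drift A B (r 1))"
proof -
  note dist = rayD(2)[OF r, of n]
  have v: "{A, B, r (Suc n), r n} \<in> V" using rayD(1)[OF r, of n] by (simp add: insert_commute)
  have F: "{A, B} \<in> F" using face_subset_vertex[OF v, of A B] dist by simp
  have "val (r n) + val (r (Suc (Suc n))) = drift A B (r n)
    + lam w (col (r (Suc n))) (col (r n)) * val (r (Suc n)) - val A * val B * val (r (Suc n))"
    unfolding drift_def using edge_value[OF v rayD(1)[OF r, of "Suc n"]] dist by auto
  \<comment> \<open>Complementary pairs of colors have the same parameter, so the face relation
    turns the coefficient of \<open>val (r (Suc n))\<close> into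
    \<open>- fval {A, B}\<close>.\<close>
  moreover have "lam w (col (r (Suc n))) (col (r n)) = lam w (col A) (col B)"
    using vertex_value_any(1)[OF v] dist by auto
  moreover have "drift A B (r n) = (if even n then drift A B (r 0) else drift A B (r 1))"
    using ray_colors[OF r, of n] by (simp add: drift_def)
  ultimately show ?thesis using face_value[OF F] by (simp add: algebra_simps)
qed

lemma face_raysE:
  assumes "{A, B} \<in> F" "A \<noteq> B"
  obtains r r' where "ray A B r" "ray A B r'" "r' 0 = r 1" "r' 1 = r 0"
proof -
  obtain v where v: "v \<in> V" "{A, B} \<subseteq> v" using face_vertices[OF assms(1)] by blast
  then obtain C D where CD: "v = {A, B, C, D}" "distinct [A, B, C, D]"
    using vertexE[of v A B] assms(2) by auto
  obtain r where r: "ray A B r" "r 0 = C" "r 1 = D" using ray_exists v CD by blast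
  have "{A, B, D, C} \<in> V" using v CD by (simp add: insert_commute)
  then obtain r' where "ray A B r'" "r' 0 = D" "r' 1 = C" using ray_exists[of A B D C] CD(2) by auto
  then show ?thesis using that r by simp
qed

lemma ray_invariant:
  assumes "ray A B r"
  shows "(4 - (fval {A, B})\<^sup>2) * ((val (r 0))\<^sup>2 + (val (r 1))\<^sup>2 + fval {A, B} * val (r 0) * val (r 1)
    - drift A B (r 0) * val (r 0) - drift A B (r 1) * val (r 1))
    + (drift A B (r 0))\<^sup>2 + (drift A B (r 1))\<^sup>2 - fval {A, B} * drift A B (r 0) * drift A B (r 1) = sg {A, B}"
  using face_invariant[of A B "r 0" "r 1"] rayD[OF assms, of 0] by auto

lemma ray_at_top:
  assumes r: "ray A B r" and f: "fval {A, B} \<notin> complex_of_real ` {-2..2}" and sg: "sg {A, B} \<noteq> 0"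
  shows "filterlim (\<lambda>n. norm (val (r n))) at_top sequentially"
  using sg ray_invariant[OF r]
  by (intro alternating_recurrence_at_top[where c = "\<lambda>n. val (r n)", OF f ray_recurrence[OF r]]) simp

text \<open>The values tend to infinity along both rays, and the rays cover the line of the
  face.\<close>

lemma finite_low_vertices:
  assumes AB: "{A, B} \<in> F" "A \<noteq> B"
    and f: "fval {A, B} \<notin> complex_of_real ` {-2..2}" and sg: "sg {A, B} \<noteq> 0"
  shows "finite {v \<in> V. {A, B} \<subseteq> v \<and> (\<exists>C\<in>v - {A, B}. norm (val C) < R)}"
proof -
  obtain r r' where r: "ray A B r" "ray A B r'" "r' 0 = r 1" "r' 1 = r 0"
    using face_raysE[OF AB] by blast
  have "\<exists>N. \<forall>n\<ge>N. R \<le> norm (val (s n))" if "ray A B s" for s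
    using ray_at_top[OF that f sg] unfolding filterlim_at_top eventually_sequentially by blast
  then obtain N N' where N: "\<And>n. n \<ge> N \<Longrightarrow> R \<le> norm (val (r n))" "\<And>n. n \<ge> N' \<Longrightarrow> R \<le> norm (val (r' n))"
    using r(1,2) by meson
  have "{v \<in> V. {A, B} \<subseteq> v \<and> (\<exists>C\<in>v - {A, B}. norm (val C) < R)} \<subseteq>
    (\<lambda>n. {A, B, r n, r (Suc n)}) ` {..<N} \<union> (\<lambda>n. {A, B, r' n, r' (Suc n)}) ` {..<N'}"
  proof
    fix v assume v: "v \<in> {v \<in> V. {A, B} \<subseteq> v \<and> (\<exists>C\<in>v - {A, B}. norm (val C) < R)}"
    then obtain C where C: "C \<in> v - {A, B}" "norm (val C) < R" by blast
    obtain n where "v = {A, B, r n, r (Suc n)} \<or> v = {A, B, r' n, r' (Suc n)}"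
      using ray_cover[OF r, of v] v by blast
    then show "v \<in> (\<lambda>n. {A, B, r n, r (Suc n)}) ` {..<N} \<union> (\<lambda>n. {A, B, r' n, r' (Suc n)}) ` {..<N'}"
    proof
      assume e: "v = {A, B, r n, r (Suc n)}"
      then have "C = r n \<or> C = r (Suc n)" using C(1) by blast
      then have "n < N" using C(2) N(1)[of n] N(1)[of "Suc n"] by (cases "n < N") auto
      then show ?thesis using e by blast
    next
      assume e: "v = {A, B, r' n, r' (Suc n)}"
      then have "C = r' n \<or> C = r' (Suc n)" using C(1) by blast
      then have "n < N'" using C(2) N(2)[of n] N(2)[of "Suc n"] by (cases "n < N'") auto
      then show ?thesis using e by blast
    qed
  qed
  then show ?thesis by (rule finite_subset) simp
qed

section \<open>Infinitely many small faces from a bounded ray\<close>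

lemma bounded_ray_infinite:
  assumes r: "ray A B r" and small: "\<And>n. {A, r n} \<in> small K"
  shows "infinite (small K)"
proof
  assume "finite (small K)"
  then have "finite (\<Union> (small K))" using card_face small_face by (metis card.infinite finite_Union zero_neq_numeral)
  moreover have "range r \<subseteq> \<Union> (small K)" using small by blast
  ultimately show False using ray_infinite[OF r] finite_subset by blast
qed

lemma ray_face: "ray A B r \<Longrightarrow> {A, r n} \<in> F"
  using face_subset_vertex[OF rayD(1)[of A B r n], of A "r n"] rayD(2)[of A B r n] by auto

text \<open>A zero at \<open>A\<close> makes every face formed by \<open>A\<close> and a region of
  the ray small, whatever the other value is.\<close>

lemma val_nonzero:
  assumes "{A, B} \<in> F" "A \<noteq> B" "0 < K" "finite (small K)"
  shows "val A \<noteq> 0"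
proof
  assume 0: "val A = 0"
  obtain r r' where r: "ray A B r" using face_raysE[OF assms(1,2)] by blast
  have "{A, r n} \<in> small K" for n
    using 0 assms(3) by (intro smallI ray_face[OF r]) auto
  then show False using bounded_ray_infinite[OF r] assms(4) by blast
qed

text \<open>If the invariant vanishes, the values on one of the two rays are bounded. For
  \<open>K\<close> above this bound and above \<open>norm (val A)\<close>, all the faces
  \<open>{A, s n}\<close> are small.\<close>

lemma sg_nonzero:
  assumes AB: "{A, B} \<in> F" "A \<noteq> B"
    and f: "fval {A, B} \<notin> complex_of_real ` {-2..2}" and fin: "\<And>K. 0 < K \<Longrightarrow> finite (small K)"
  shows "sg {A, B} \<noteq> 0"
proof
  assume 0: "sg {A, B} = 0"
  obtain r r' where r: "ray A B r" "ray A B r'" "r' 0 = r 1" "r' 1 = r 0"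
    using face_raysE[OF AB] by blast
  \<comment> \<open>As \<open>r'\<close> starts with the first two regions of \<open>r\<close> in
    opposite order, its recurrence has the same drifts, exchanged.\<close>
  have "(\<exists>T. \<forall>n. norm (val (r n)) \<le> T) \<or> (\<exists>T. \<forall>n. norm (val (r' n)) \<le> T)"
    by (rule alternating_recurrence_bounded[where c = "\<lambda>n. val (r n)" and d = "\<lambda>n. val (r' n)",
          OF f ray_recurrence[OF r(1)] ray_recurrence[OF r(2), unfolded r(3,4)]])
      (use r(3,4) ray_invariant[OF r(1)] 0 in simp_all)
  then obtain s T where s: "ray A B s" "\<And>n. norm (val (s n)) \<le> T" using r by blast
  define K where "K = max T (norm (val A)) + 1"
  have K: "norm (val A) < K" "\<And>n. norm (val (s n)) < K" "0 < K"
    using s(2) norm_ge_zero[of "val A"] unfolding K_def by (smt (verit))+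
  have "{A, s n} \<in> small K" for n
  proof (rule smallI[OF ray_face[OF s(1)]])
    show "norm (val A) * norm (val (s n)) < K\<^sup>2"
      unfolding power2_eq_square using K by (intro mult_strict_mono) auto
  qed (use K in auto)
  then show False using bounded_ray_infinite[OF s(1)] fin[OF K(3)] by blast
qed

subsection \<open>Finiteness\<close>

text \<open>A threshold \<open>R\<close> beyond which the values along the face \<open>{A, B}\<close> dominate everything else.\<close>

definition dominates :: "real \<Rightarrow> real \<Rightarrow> 'a \<Rightarrow> 'a \<Rightarrow> bool" where
  "dominates K R A B \<longleftrightarrow> 0 < K \<and> K \<le> R \<and> val A \<noteq> 0 \<and> K\<^sup>2 + 4 * M + 2 \<le> R * norm (val A) \<and>
    K + (K\<^sup>2 + 2 * M) / norm (val A) + norm (val B) + M * norm (val A) < 2 * R"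

lemma dominates_exists:
  assumes "0 < K" "val A \<noteq> 0" "val B \<noteq> 0"
  obtains R where "dominates K R A B" "dominates K R B A"
proof -
  define P where "P = K\<^sup>2 + 4 * M + 2"
  define a b where "a = norm (val A)" and "b = norm (val B)"
  \<comment> \<open>The sum of everything that both instances of \<open>dominates\<close> ask for,
    so that each inequality follows by dropping positive terms.\<close>
  define R where "R = K + P / a + P / b + (a + b + M * a + M * b)"
  have ab: "0 < a" "0 < b" using assms by (simp_all add: a_def b_def)
  have P: "0 < P" "K\<^sup>2 + 2 * M \<le> P"
    using max_norm_nonneg[of w] zero_le_power2[of K] unfolding P_def by linarith+
  have nn: "0 < P / a" "0 < P / b" "(K\<^sup>2 + 2 * M) / a \<le> P / a" "(K\<^sup>2 + 2 * M) / b \<le> P / b"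
    "0 \<le> M * a" "0 \<le> M * b"
    using ab P max_norm_nonneg[of w] by (simp_all add: divide_right_mono)
  have sum: "k + x + d + m < 2 * (k + p + q + (c + d + m + n))"
    if "x \<le> p" "0 < p" "0 < q" "0 < k" "0 < c" "0 < d" "0 \<le> m" "0 \<le> n" for k x c d m n p q :: real
    using that by (smt (verit))
  have "K + (K\<^sup>2 + 2 * M) / a + b + M * a < 2 * R"
    unfolding R_def by (rule sum[OF nn(3,1,2) assms(1) ab nn(5,6)])
  moreover have "K + (K\<^sup>2 + 2 * M) / b + a + M * b < 2 * R"
    using sum[OF nn(4,2,1) assms(1) ab(2,1) nn(6,5)] unfolding R_def by (simp add: ac_simps)
  moreover have "K \<le> R" "P / a \<le> R" "P / b \<le> R"
    using nn assms(1) ab unfolding R_def by linarith+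
  ultimately have R: "K \<le> R" "P / a \<le> R" "P / b \<le> R"
    "K + (K\<^sup>2 + 2 * M) / a + b + M * a < 2 * R" "K + (K\<^sup>2 + 2 * M) / b + a + M * b < 2 * R"
    by simp_all
  then have "P \<le> R * a" "P \<le> R * b" using ab by (simp_all add: pos_divide_le_eq)
  then show ?thesis using that[of R] R assms unfolding dominates_def P_def a_def b_def by simp
qed

lemma high_not_small:
  assumes "0 < K" "K \<le> R" "R \<le> norm (val C)"
    and "R \<le> norm (val X) \<or> K\<^sup>2 + 4 * M + 2 \<le> R * norm (val X)"
  shows "{X, C} \<notin> small K"
proof
  assume s: "{X, C} \<in> small K"
  have "R * norm (val X) \<le> norm (val X) * norm (val C)"
    using mult_right_mono[OF assms(3), of "norm (val X)"] by (simp add: mult.commute)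
  then have "norm (val X) < K \<or> norm (val C) < K" "R * norm (val X) < K\<^sup>2 + 2 * M"
    using s small_iff[OF small_face[OF s]] small_product[OF s] by auto
  then show False using assms max_norm_nonneg[of w] by linarith
qed

lemma high_vertex:
  assumes dom: "dominates K R A B" "dominates K R B A"
    and high: "R \<le> norm (val C)" "R \<le> norm (val D)"
    and xi: "xi \<in> small K" "xi \<subseteq> {A, B, C, D}"
  shows "xi = {A, B}"
proof -
  obtain X Y where XY: "xi = {X, Y}" "X \<noteq> Y" using small_face[OF xi(1)] by (rule faceE)
  have no: "{Z, C} \<notin> small K" "{Z, D} \<notin> small K" if "Z \<in> {A, B, C, D}" for Z
    by (rule high_not_small[of K R]; use that dom high in \<open>auto simp: dominates_def\<close>)+
  have "C \<notin> xi" "D \<notin> xi"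
    using no[of X] no[of Y] xi unfolding XY(1) by (auto simp: insert_commute)
  then show ?thesis using xi(2) XY by auto
qed

text \<open>Here the line of \<open>{A, B}\<close> is left by replacing \<open>A\<close> with
  \<open>E\<close>. By \<open>high_vertex\<close> a small face must contain \<open>E\<close>, which
  bounds \<open>norm (val E)\<close>. But the edge relation makes
  \<open>norm (val A) + norm (val E)\<close> at least \<open>2 * R - M * norm (val B)\<close>, too
  much for \<open>dominates K R B A\<close>.\<close>

lemma high_neighbour:
  assumes v: "{B, C, D, A} \<in> V" "{B, C, D, E} \<in> V" and dist: "distinct [B, C, D, A, E]"
    and dom: "dominates K R A B" "dominates K R B A"
    and high: "R \<le> norm (val C)" "R \<le> norm (val D)"
    and xi: "xi \<in> small K" "xi \<subseteq> {B, C, D, E}"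
  shows False
proof -
  have d: "0 < K" "K \<le> R" "0 < norm (val B)" "K\<^sup>2 + 4 * M + 2 \<le> R * norm (val B)"
    "K + (K\<^sup>2 + 2 * M) / norm (val B) + norm (val A) + M * norm (val B) < 2 * R"
    using dom(2) by (auto simp: dominates_def)
  have "E \<in> xi"
  proof (rule ccontr)
    assume "E \<notin> xi"
    then have "xi = {A, B}" using xi by (intro high_vertex[OF dom high xi(1)]) auto
    then show False using xi(2) dist by auto
  qed
  moreover obtain X Y where "xi = {X, Y}" "X \<noteq> Y" using small_face[OF xi(1)] by (rule faceE)
  ultimately obtain Y where Y: "xi = {E, Y}" "Y \<in> {B, C, D}"
    using xi(2) by (auto simp: insert_commute)
  \<comment> \<open>With \<open>B\<close> as the other region the bound comes from the product;
    \<open>C\<close> and \<open>D\<close> have values of size at least \<open>R\<close>, hence at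
    least \<open>K\<close>, so beside them \<open>E\<close> itself must be below
    \<open>K\<close>.\<close>
  have E: "norm (val E) \<le> K + (K\<^sup>2 + 2 * M) / norm (val B)"
  proof (cases "Y = B")
    case True
    have "norm (val E) * norm (val B) < K\<^sup>2 + 2 * M" using small_product xi(1) Y(1) True by simp
    then have "norm (val E) \<le> (K\<^sup>2 + 2 * M) / norm (val B)" using d(3) by (simp add: pos_le_divide_eq)
    then show ?thesis using d(1) by linarith
  next
    case False
    then have "K \<le> norm (val Y)" using Y(2) d(2) high by auto
    then have "norm (val E) < K" using small_iff[of E Y K] small_face[OF xi(1)] xi(1) unfolding Y(1) by auto
    moreover have "0 \<le> (K\<^sup>2 + 2 * M) / norm (val B)" using max_norm_nonneg[of w] by simp
    ultimately show ?thesis by linarith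
  qed
  define b c e where "b = norm (val B)" and "c = norm (val C)" and "e = norm (val D)"
  have ce: "R \<le> c" "R \<le> e" "0 < R" "0 < b" "2 * M + 2 \<le> R * b"
    using high d zero_le_power2[of K] max_norm_nonneg[of w]
    unfolding b_def c_def e_def by linarith+
  \<comment> \<open>Averaging the two bounds gives \<open>(M + 1) * (c + e) \<le> b * c * e\<close>:
    the \<open>M\<close> absorbs linear terms of the edge relation, and the \<open>1\<close> leaves
    \<open>c + e\<close>.\<close>
  have "(2 * M + 2) * e \<le> R * b * e" "(2 * M + 2) * c \<le> R * b * c"
    using ce by (auto intro!: mult_right_mono)
  moreover have "R * (b * e) \<le> c * (b * e)" "R * (b * c) \<le> e * (b * c)"
    using ce by (auto intro!: mult_right_mono)
  ultimately have "(2 * M + 2) * e \<le> b * c * e" "(2 * M + 2) * c \<le> b * c * e"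
    by (simp_all add: ac_simps)
  then have "(M + 1) * (c + e) \<le> b * c * e" by (simp add: algebra_simps)
  moreover have "b * c * e - M * (b + c + e) \<le> norm (val A) + norm (val E)"
    using edge_value_norm[OF v dist] by (simp add: b_def c_def e_def)
  ultimately have "c + e - M * b \<le> norm (val A) + norm (val E)" by (simp add: algebra_simps)
  then show False using E d(5) ce unfolding b_def by linarith
qed

text \<open>The form in which growth along \<open>eta\<close> enters the step from \<open>K\<close>
  to \<open>K + 1/4\<close>. Neighbours containing \<open>eta\<close> are exempt, since the
  neighbours to be examined there are not thin and so miss \<open>eta\<close>.\<close>

definition lone :: "real \<Rightarrow> 'a set \<Rightarrow> 'a set \<Rightarrow> bool" where
  "lone K eta v \<longleftrightarrow> (\<forall>xi\<in>small K. (xi \<subseteq> v \<longrightarrow> xi = eta) \<and> (\<forall>u. adj u v \<longrightarrow> \<not> eta \<subseteq> u \<longrightarrow> \<not> xi \<subseteq> u))"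

lemma loneD:
  assumes "lone K eta v" "xi \<in> small K"
  shows "xi \<subseteq> v \<Longrightarrow> xi = eta" "adj u v \<Longrightarrow> \<not> eta \<subseteq> u \<Longrightarrow> \<not> xi \<subseteq> u"
  using assms unfolding lone_def by simp_all

text \<open>Outside a finite set both remaining values at a vertex around the face are at least
  \<open>R\<close>. Then \<open>high_vertex\<close> settles the vertex itself, and
  \<open>high_neighbour\<close> the edges that replace \<open>A\<close> or \<open>B\<close>.\<close>

lemma face_tail:
  assumes K: "0 < K" and AB: "{A, B} \<in> F" "A \<noteq> B" and nz: "val A \<noteq> 0" "val B \<noteq> 0"
    and f: "fval {A, B} \<notin> complex_of_real ` {-2..2}" and sg: "sg {A, B} \<noteq> 0"
  shows "\<exists>L. finite L \<and> L \<subseteq> V \<and> (\<forall>v\<in>V - L. {A, B} \<subseteq> v \<longrightarrow> lone K {A, B} v)"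
proof -
  obtain R where dom: "dominates K R A B" "dominates K R B A" using dominates_exists[OF K nz] .
  define L where "L = {v \<in> V. {A, B} \<subseteq> v \<and> (\<exists>C\<in>v - {A, B}. norm (val C) < R)}"
  have "finite L" unfolding L_def by (rule finite_low_vertices[OF AB f sg])
  moreover
  have "(xi \<subseteq> v \<longrightarrow> xi = {A, B}) \<and> (\<forall>u. adj u v \<longrightarrow> \<not> {A, B} \<subseteq> u \<longrightarrow> \<not> xi \<subseteq> u)"
    if v: "v \<in> V - L" "{A, B} \<subseteq> v" and xi: "xi \<in> small K" for v xi
  proof -
    obtain C D where CD: "v = {A, B, C, D}" "distinct [A, B, C, D]"
      using vertexE[of v A B] v AB(2) by auto
    have "C \<in> v - {A, B}" "D \<in> v - {A, B}" using CD by auto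
    then have high: "R \<le> norm (val C)" "R \<le> norm (val D)" using v unfolding L_def by force+
    have "\<not> xi \<subseteq> u" if u: "adj u v" "\<not> {A, B} \<subseteq> u" for u
    proof
      assume sub: "xi \<subseteq> u"
      obtain X E where E: "X \<in> v" "E \<notin> v" "u = insert E (v - {X})" using adj_sym[OF u(1)] by (rule adjE)
      have uV: "u \<in> V" using u(1) by (simp add: adj_in_def)
      have "X = A \<or> X = B" using E v(2) u(2) by auto
      then show False
      proof
        assume X: "X = A"
        have "{B, C, D, A} = v" "{B, C, D, E} = u" using CD E X by auto
        then show False using high_neighbour[OF _ _ _ dom high xi, of E] CD(2) E(2) v uV sub by auto
      next
        assume X: "X = B"
        have "{A, C, D, B} = v" "{A, C, D, E} = u" using CD E X by auto
        then show False using high_neighbour[OF _ _ _ dom(2,1) high xi, of E] CD(2) E(2) v uV sub by auto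
      qed
    qed
    moreover have "xi = {A, B}" if "xi \<subseteq> v"
      using high_vertex[OF dom high xi] that CD(1) by simp
    ultimately show ?thesis by blast
  qed
  then have "\<forall>v\<in>V - L. {A, B} \<subseteq> v \<longrightarrow> lone K {A, B} v" unfolding lone_def by simp
  moreover have "L \<subseteq> V" unfolding L_def by (rule Collect_restrict)
  ultimately show ?thesis by metis
qed

section \<open>The step from \<open>K\<close> to \<open>K + 1/4\<close>\<close>

lemma finite_neighbours:
  assumes "v \<in> V"
  shows "finite {u. adj u v}"
proof -
  have "{u. adj u v} \<subseteq> (\<Union>e\<in>{e \<in> Pow v. card e = 3}. {u \<in> V. e \<subseteq> u})"
  proof
    fix u assume "u \<in> {u. adj u v}"
    then show "u \<in> (\<Union>e\<in>{e \<in> Pow v. card e = 3}. {u \<in> V. e \<subseteq> u})"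
      by (intro UN_I[of "u \<inter> v"]) (simp_all add: adj_in_def)
  qed
  moreover have "finite {u \<in> V. e \<subseteq> u}" if "e \<in> {e \<in> Pow v. card e = 3}" for e
    using two_vertices[OF assms, of e] that by (intro card_ge_0_finite) simp
  moreover have "finite {e \<in> Pow v. card e = 3}" using finite_vertex[OF assms] by simp
  ultimately show ?thesis by (meson finite_UN_I finite_subset)
qed

context
  assumes fval: "\<And>xi. xi \<in> F \<Longrightarrow> fval xi \<notin> complex_of_real ` {-2..2}"
    and sg_nz: "\<And>xi. xi \<in> F \<Longrightarrow> sg xi \<noteq> 0"
begin

text \<open>Finiteness at level \<open>K\<close> serves to make both values on \<open>eta\<close>
  nonzero; the conclusion already concerns level \<open>K + 1/4\<close>.\<close>

lemma small_face_tail: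
  assumes K: "0 < K" and fin: "finite (small K)" and xi: "eta \<in> F"
  shows "\<exists>L. finite L \<and> L \<subseteq> V \<and> (\<forall>v\<in>V - L. eta \<subseteq> v \<longrightarrow> lone (K + 1/4) eta v)"
proof -
  obtain A B where AB: "eta = {A, B}" "A \<noteq> B" using xi by (rule faceE)
  have F: "{A, B} \<in> F" "{B, A} \<in> F" using xi AB(1) by (simp_all add: insert_commute)
  show ?thesis
    unfolding AB(1)
    by (rule face_tail[OF _ F(1) AB(2) val_nonzero[OF F(1) AB(2) K fin]
          val_nonzero[OF F(2) AB(2)[symmetric] K fin] fval[OF F(1)] sg_nz[OF F(1)]])
      (use K in simp)
qed

text \<open>If no face is small for \<open>K\<close>, the faces small for \<open>K + 1/4\<close> all
  share a vertex with a fixed one of them, \<open>eta\<close>. Otherwise each has a vertex within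
  distance one of a vertex that contains some \<open>eta\<close> in \<open>small K\<close>. In both
  cases the face is \<open>eta\<close> unless the vertex containing \<open>eta\<close> is one of
  finitely many exceptions.\<close>

lemma finite_small_step:
  assumes K: "2 + M \<le> K" and fin: "finite (small K)"
  shows "finite (small (K + 1/4))"
proof (cases "small K = {}")
  case True
  have K0: "0 < K" using K max_norm_nonneg[of w] by simp
  show ?thesis
  proof (cases "small (K + 1/4) = {}")
    case False
    then obtain eta where eta: "eta \<in> small (K + 1/4)" by blast
    obtain L where L: "finite L" "L \<subseteq> V"
      "\<forall>v\<in>V - L. eta \<subseteq> v \<longrightarrow> lone (K + 1/4) eta v"
      using small_face_tail[OF K0 fin small_face[OF eta]] by blast
    have "small (K + 1/4) \<subseteq> insert eta (\<Union>v\<in>L. Pow v)"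
    proof
      fix xi assume xi: "xi \<in> small (K + 1/4)"
      obtain v where "v \<in> V" "xi \<subseteq> v" "eta \<subseteq> v" using small_faces_meet[OF K True xi eta] .
      then show "xi \<in> insert eta (\<Union>v\<in>L. Pow v)" 
        using L(3) loneD(1)[OF _ xi, of eta v] by (cases "v \<in> L") auto
    qed
    moreover have "finite (insert eta (\<Union>v\<in>L. Pow v))" using L(1,2) finite_vertex by (simp add: subset_iff)
    ultimately show ?thesis by (rule finite_subset)
  qed simp
next
  case False
  have K0: "0 < K" using K max_norm_nonneg[of w] by simp
  have "\<exists>L. \<forall>eta\<in>small K. finite (L eta) \<and> L eta \<subseteq> V \<and> (\<forall>v\<in>V - L eta. eta \<subseteq> v \<longrightarrow> lone (K + 1/4) eta v)"
    using small_face_tail[OF K0 fin small_face] by (intro bchoice) blast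
  then obtain L where L: "\<forall>eta\<in>small K. finite (L eta) \<and> L eta \<subseteq> V \<and>
    (\<forall>v\<in>V - L eta. eta \<subseteq> v \<longrightarrow> lone (K + 1/4) eta v)" by blast
  \<comment> \<open>The exceptional vertices of the finitely many faces in \<open>small K\<close>,
    together with their neighbours because distance one is possible.\<close>
  define U where "U = (\<Union>eta\<in>small K. \<Union>v\<in>L eta. insert v {u. adj u v})"
  have "small (K + 1/4) \<subseteq> small K \<union> (\<Union>u\<in>U. Pow u)"
  proof
    fix xi assume xi: "xi \<in> small (K + 1/4)"
    obtain u v where uv: "u \<in> V" "xi \<subseteq> u" "v \<in> V" "thin K v" "u = v \<or> adj u v \<and> \<not> thin K u"
      using small_face_near_thin[OF K False xi] .
    obtain eta where eta: "eta \<in> small K" "eta \<subseteq> v" using uv(4) unfolding thin_def by blast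
    show "xi \<in> small K \<union> (\<Union>u\<in>U. Pow u)"
    proof (cases "v \<in> L eta")
      case True
      then have "u \<in> U" using eta(1) uv(5) unfolding U_def by blast
      then show ?thesis using uv(2) by blast
    next
      case False
      have lone: "lone (K + 1/4) eta v" using L eta uv(3) False by simp
      \<comment> \<open>A neighbour that is not thin misses \<open>eta\<close>, so
        \<open>lone\<close> leaves no room there for \<open>xi\<close>.\<close>
      have "\<not> eta \<subseteq> u" if "\<not> thin K u" using that eta(1) unfolding thin_def by blast
      then have "u = v" using uv(2,5) loneD(2)[OF lone xi] by metis
      then have "xi = eta" using uv(2) loneD(1)[OF lone xi] by simp
      then show ?thesis using eta(1) by simp
    qed
  qed
  moreover have "finite U" "U \<subseteq> V"
    using fin L finite_neighbours unfolding U_def by (force simp: adj_in_def)+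
  then have "finite (small K \<union> (\<Union>u\<in>U. Pow u))" using fin finite_vertex by auto
  ultimately show ?thesis by (rule finite_subset)
qed

text \<open>The increment \<open>1/4\<close> is the same at every level, so finitely many steps from
  \<open>2 + M\<close> pass any \<open>K\<close>.\<close>

lemma finite_small:
  assumes "finite (small (2 + M))" "0 < K"
  shows "finite (small K)"
proof -
  have "finite (small (2 + M + real n / 4))" for n
  proof (induction n)
    case (Suc n)
    have "finite (small (2 + M + real n / 4 + 1 / 4))"
      using Suc by (intro finite_small_step) simp_all
    then show ?case by (simp add: field_simps)
  qed (use assms(1) in simp)
  moreover obtain n where "4 * K \<le> real n" using real_arch_simple by blast
  then have "small K \<subseteq> small (2 + M + real n / 4)"
    using assms(2) max_norm_nonneg[of w] by (intro small_mono) auto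
  ultimately show ?thesis using finite_subset by blast
qed

end

theorem Bowditch_conditions_iff:
  "(\<forall>xi\<in>F. fval xi \<notin> complex_of_real ` {-2..2}) \<and> (\<forall>xi\<in>F. sg xi \<noteq> 0) \<and> finite (small (2 + M)) \<longleftrightarrow>
   (\<forall>xi\<in>F. fval xi \<notin> complex_of_real ` {-2..2}) \<and> (\<forall>K>0. finite (small K))"
proof (intro iffI)
  assume "(\<forall>xi\<in>F. fval xi \<notin> complex_of_real ` {-2..2}) \<and> (\<forall>xi\<in>F. sg xi \<noteq> 0) \<and> finite (small (2 + M))"
  then have f: "\<forall>xi\<in>F. fval xi \<notin> complex_of_real ` {-2..2}" and g: "\<forall>xi\<in>F. sg xi \<noteq> 0"
    and fin: "finite (small (2 + M))" by simp_all
  have "\<forall>K>0. finite (small K)" using finite_small[OF bspec[OF f] bspec[OF g] fin] by simp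
  with f show "(\<forall>xi\<in>F. fval xi \<notin> complex_of_real ` {-2..2}) \<and> (\<forall>K>0. finite (small K))" ..
next
  assume "(\<forall>xi\<in>F. fval xi \<notin> complex_of_real ` {-2..2}) \<and> (\<forall>K>0. finite (small K))"
  then have f: "\<forall>xi\<in>F. fval xi \<notin> complex_of_real ` {-2..2}" and fin: "\<And>K. 0 < K \<Longrightarrow> finite (small K)"
    by simp_all
  have "sg xi \<noteq> 0" if "xi \<in> F" for xi
  proof -
    obtain A B where AB: "xi = {A, B}" "A \<noteq> B" using \<open>xi \<in> F\<close> by (rule faceE)
    show ?thesis
      using sg_nonzero[OF that[unfolded AB(1)] AB(2) bspec[OF f that, unfolded AB(1)] fin] unfolding AB(1) .
  qed
  moreover have "finite (small (2 + M))" by (rule fin) (use max_norm_nonneg[of w] in linarith)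
  ultimately show "(\<forall>xi\<in>F. fval xi \<notin> complex_of_real ` {-2..2}) \<and> (\<forall>xi\<in>F. sg xi \<noteq> 0) \<and> finite (small (2 + M))"
    using f by simp
qed

end

section \<open>The curve complex\<close>

lemma once_cliques_card: "s \<in> once_cliques n \<Longrightarrow> card s = n"
  by (simp add: once_cliques_def)

lemma once_cliques_regions: "s \<in> once_cliques n \<Longrightarrow> A \<in> s \<Longrightarrow> A \<in> regions"
  unfolding once_cliques_def by (drule CollectD) (erule conjE, erule (1) subsetD)

lemma once_cliques_subset:
  assumes s: "s \<in> once_cliques n" and t: "t \<subseteq> s"
  shows "t \<in> once_cliques (card t)"
proof -
  have "s \<subseteq> S1" "finite s" "\<forall>A\<in>s. \<forall>B\<in>s. A \<noteq> B \<longrightarrow> geom_intersection A B = 1"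
    using s by (simp_all add: once_cliques_def)
  then have "t \<subseteq> S1" "finite t" "\<forall>A\<in>t. \<forall>B\<in>t. A \<noteq> B \<longrightarrow> geom_intersection A B = 1"
    using t subset_trans[of t s S1] finite_subset[of t s] by (simp_all add: subset_iff)
  then show ?thesis by (simp add: once_cliques_def)
qed

text \<open>Any subset of a vertex is again a clique, so only its size decides whether it is an
  edge.\<close>

lemma adjacent_iff: "adjacent u v \<longleftrightarrow> adj_in vertices u v"
proof -
  have "u \<inter> v \<in> edges \<longleftrightarrow> card (u \<inter> v) = 3" if "u \<in> vertices"
    using once_cliques_subset[OF that Int_lower1, of v] once_cliques_card[of "u \<inter> v" 3] by metis
  then show ?thesis unfolding adjacent_def adj_in_def by metis
qed

lemma connected_vertices_iff: "connected_vertices U \<longleftrightarrow> connected_in vertices U"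
  unfolding connected_vertices_def connected_in_def adjacent_iff ..

lemma Markoff_tree_curves:
  assumes tree: "Upsilon_dual_tree" and coloring: "region_coloring col"
    and psi: "psi \<in> Markoff_maps col w"
  shows "Markoff_tree vertices faces col w (\<lambda>A. psi (Inl A)) (\<lambda>xi. psi (Inr xi)) (sigma col w psi)"
proof
  note T = tree[unfolded Upsilon_dual_tree_def connected_vertices_iff vertices_at_def, THEN conjunct2]
  note conn = T[THEN conjunct1] and cycles = T[THEN conjunct2, THEN conjunct1]
    and two = T[THEN conjunct2, THEN conjunct2, THEN conjunct1]
    and dual = T[THEN conjunct2, THEN conjunct2, THEN conjunct2]
  have rel: "vertex_relation col w psi" "edge_relation col w psi" "face_relation col w psi"
    using psi by (simp_all add: Markoff_maps_def)
  have inj: "inj_on col v" if "v \<in> vertices" for v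
    using coloring that unfolding region_coloring_def by metis
  have range: "col A \<in> {1..4}" if "A \<in> regions" for A
    using coloring that unfolding region_coloring_def by metis
  show "card v = 4" if "v \<in> vertices" for v using once_cliques_card[OF that] .
  show card2: "card xi = 2" if "xi \<in> faces" for xi using once_cliques_card[OF that] .
  show "xi \<in> faces" if "v \<in> vertices" "xi \<subseteq> v" "card xi = 2" for v xi
    using once_cliques_subset[OF that(1,2)] unfolding that(3) .
  have edge: "e \<in> edges" if "v \<in> vertices" "e \<subseteq> v" "card e = 3" for v e
    using once_cliques_subset[OF that(1,2)] unfolding that(3) .
  show "card {u \<in> vertices. e \<subseteq> u} = 2" if "v \<in> vertices" "e \<subseteq> v" "card e = 3" for v e
    using bspec[OF two edge[OF that]] .
  show "connected_in vertices vertices" using conn .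
  show "\<exists>i<length us. \<not> adj_in vertices (us ! i) (us ! ((i + 1) mod length us))"
    if "3 \<le> length us" "distinct us" for us
    using cycles that unfolding no_cycles_def adjacent_iff by metis
  have face: "{v \<in> vertices. xi \<subseteq> v} \<noteq> {} \<and> connected_in vertices {v \<in> vertices. xi \<subseteq> v}"
    if "xi \<in> faces" for xi
    using mp[OF spec[OF dual] UnI2[OF that]] .
  show "{v \<in> vertices. xi \<subseteq> v} \<noteq> {}" if "xi \<in> faces" for xi using face[OF that] ..
  show "connected_in vertices {v \<in> vertices. xi \<subseteq> v}" if "xi \<in> faces" for xi using face[OF that] ..
  show "inj_on col v" if "v \<in> vertices" for v using inj[OF that] .
  show "col A \<in> {1..4}" if "v \<in> vertices" "A \<in> v" for v A
    using range once_cliques_regions[OF that] by metis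
  show "(psi (Inl A1))\<^sup>2 + (psi (Inl A2))\<^sup>2 + (psi (Inl A3))\<^sup>2 + (psi (Inl A4))\<^sup>2
      + psi (Inl A1) * psi (Inl A2) * psi (Inl A3) * psi (Inl A4) =
      x * (psi (Inl A1) * psi (Inl A2) + psi (Inl A3) * psi (Inl A4))
      + y * (psi (Inl A2) * psi (Inl A3) + psi (Inl A1) * psi (Inl A4))
      + z * (psi (Inl A1) * psi (Inl A3) + psi (Inl A2) * psi (Inl A4)) + 4 - x\<^sup>2 - y\<^sup>2 - z\<^sup>2 - x * y * z"
    if "{A1, A2, A3, A4} \<in> vertices" "col A1 = 1" "col A2 = 2" "col A3 = 3" "col A4 = 4" "w = (x, y, z)"
    for A1 A2 A3 A4 x y z
    using rel(1)[unfolded vertex_relation_def that(6) prod.case Let_def, rule_format, OF conjI, OF that(1)] that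
    by simp
  show "psi (Inl D) + psi (Inl D') = lam w (col A) (col D) * psi (Inl A) + lam w (col B) (col D) * psi (Inl B)
      + lam w (col C) (col D) * psi (Inl C) - psi (Inl A) * psi (Inl B) * psi (Inl C)"
    if "{A, B, C, D} \<in> vertices" "{A, B, C, D'} \<in> vertices" "distinct [A, B, C, D, D']" for A B C D D'
  proof -
    have "card {A, B, C} = 3" "D \<noteq> D'" using that(3) by simp_all
    moreover have "{A, B, C} \<subseteq> {A, B, C, D}" by simp
    ultimately show ?thesis
      using rel(2)[unfolded edge_relation_def, rule_format, of A B C D D'] edge[OF that(1)] that(1,2) by metis
  qed
  show "psi (Inl A) * psi (Inl B) = lam w (col A) (col B) + psi (Inr {A, B})" if "{A, B} \<in> faces" for A B
    using rel(3)[unfolded face_relation_def, rule_format, OF that] .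
  show "sigma col w psi {A, B} =
      ((psi (Inl A))\<^sup>2 + (psi (Inl B))\<^sup>2 + (lam w (col A) (col B))\<^sup>2
        - psi (Inl A) * psi (Inl B) * lam w (col A) (col B) - 4) *
      ((lam w (col A) k)\<^sup>2 + (lam w (col B) k)\<^sup>2 + (psi (Inr {A, B}))\<^sup>2
        - lam w (col A) k * lam w (col B) k * psi (Inr {A, B}) - 4)"
    if AB: "{A, B} \<in> faces" and k: "k \<in> {1..4} - {col A, col B}" for A B k
  proof -
    have ne: "A \<noteq> B" using card2[OF AB] by (cases "A = B") simp_all
    \<comment> \<open>The coloring separates regions at a common vertex, and duality supplies a
      vertex containing the face.\<close>
    obtain v where v: "v \<in> vertices" "{A, B} \<subseteq> v" using face[OF AB] by blast
    then have in_v: "A \<in> v" "B \<in> v" by simp_all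
    then have "col A \<noteq> col B" using inj_onD[OF inj[OF v(1)]] ne by metis
    moreover have "col A \<in> {1..4}" "col B \<in> {1..4}"
      using range once_cliques_regions[OF v(1)] in_v by metis+
    ultimately show ?thesis
      using sigma_eq[OF _ _ _ k] unfolding sigma_value_def Let_def by simp
  qed
qed

theorem proposition4p10:
  fixes w :: "complex \<times> complex \<times> complex"
    and col :: "region \<Rightarrow> nat"
    and psi :: "region + region set \<Rightarrow> complex"
  assumes "Upsilon_dual_tree"
    and "region_coloring col"
    and "psi \<in> Markoff_maps col w"
  shows "psi \<in> Bowditch_set col w \<longleftrightarrow>
    (\<forall>xi\<in>faces. psi (Inr xi) \<notin> complex_of_real ` {-2..2}) \<and>
    (\<forall>K>0. finite (small_faces w psi K))"
proof -
  interpret Markoff_tree vertices faces col w "\<lambda>A. psi (Inl A)" "\<lambda>xi. psi (Inr xi)" "sigma col w psi"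
    using Markoff_tree_curves[OF assms] .
  \<comment> \<open>Elements of faces are regions, so \<open>small\<close>, which does not mention
    regions, agrees with \<open>small_faces\<close>.\<close>
  have "A \<in> small_regions psi K \<longleftrightarrow> norm (psi (Inl A)) < K" if "xi \<in> faces" "A \<in> xi" for xi A K
    using once_cliques_regions[OF that] by (simp add: small_regions_def)
  then have "small_faces w psi K = small K" for K
    unfolding small_faces_def small_def by (intro Collect_cong conj_cong refl bex_cong) simp_all
  then show ?thesis
    using Bowditch_conditions_iff assms(3) by (simp add: Bowditch_set_def)
qed

end
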